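(* Let $(\cdot)^{\dagger}$ denote either $(\cdot)^{H}$ or $(\cdot)^{T}$. Let $\mathcal{D}^{(1)},\dots,\mathcal{D}^{(L)}\in\mathbb{C}^{n_1\times n_2\times\cdots\times n_d}$ be diagonal tensors, $\alpha_1,\dots,\alpha_L\in\mathbb{R}^{+}$, let $Q_i$ be an orthogonal $n_i\times n_i$ matrix for $1\le i\le d$, and let $$\mathcal{A}^{(\ell)}=\mathcal{D}^{(\ell)}\bullet_1(Q_1^{H})^{\dagger}\cdots\bullet_d(Q_d^{H})^{\dagger},\qquad 1\le\ell\le L.$$ Suppose that $r=r_1=\cdots=r_d$ with $1\le r\le n_i$ for all $i$, and that (a) $\sum_{\ell=1}^{L}\alpha_\ell\big(|\mathcal{D}^{(\ell)}_{r_1+s,\dots,r_1+s}|^2-|\mathcal{D}^{(\ell)}_{t\cdots t}|^2\big)\ne0$ for all $1\le s\le r-r_1$ and $1\le t\le r_1$ (an empty requirement since $r_1=r$); (b) $\sum_{\ell=1}^{L}\alpha_\ell|\mathcal{D}^{(\ell)}_{p\cdots p}|^2\ne0$ for all $1\le p\le r_1$ (only required if $r<n_i$ for some $i$). Then $\omega_0=(Q_1I_{n_1\times r},\dots,Q_dI_{n_d\times r})$ is a unitarily semi-nondegenerate point of the function $$f(U^{(1)},\dots,U^{(d)})=\sum_{\ell=1}^{L}\alpha_\ell\|\mathcal{W}^{(\ell)}\|^2,\qquad \mathcal{W}^{(\ell)}=\mathcal{A}^{(\ell)}\bullet_1(U^{(1)})^{\dagger}\cdots\bullet_d(U^{(d)})^{\dagger},\qquad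 U^{(i)}\in\mathrm{St}(r,n_i,\mathbb{C}).$$
   Context: $d>1$; $\mathrm{St}(r,n,\mathbb{C})=\{X\in\mathbb{C}^{n\times r}:X^{H}X=I_r\}$; $X^T$, $X^H$ are transpose and conjugate transpose; $\mathbb{R}^{+}=[0,\infty)$. $I_{n\times r}$ is the $n\times r$ matrix with ones on the diagonal and zeros elsewhere. Mode product: for $\mathcal{A}\in\mathbb{C}^{n_1\times\cdots\times n_d}$ and $X\in\mathbb{C}^{m\times n_i}$, $(\mathcal{A}\bullet_iX)_{p_1\cdots q\cdots p_d}=\sum_{p_i}\mathcal{A}_{p_1\cdots p_i\cdots p_d}X_{qp_i}$ ($q$ in position $i$). A tensor is diagonal if its only nonzero entries are among the diagonal entries $\mathcal{D}_{p\cdots p}$. $\|\cdot\|$ is the Frobenius norm of a tensor. Orthogonal matrices are real. $\mathrm{St}(r,n,\mathbb{C})$ is a Riemannian submanifold of $\mathbb{C}^{n\times r}$ with real inner product $\Re\,\mathrm{tr}(X^{H}Y)$. $h:\mathrm{St}(r,n,\mathbb{C})\to\mathbb{R}$ is unitarily invariant if $h(UR)=h(U)$ for all unitary $R\in\mathbb{C}^{r\times r}$; $U$ is a unitarily semi-nondegenerate point of $h$ if $h$ is unitarily invariant, the Riemannian gradient of $h$ vanishes at $U$, and the Riemannian Hessian $\mathrm{Hess}\,h(U)$ (a real-linear self-map of the tangent space) has real rank $2r(n-r)$. A point $\omega=(U^{(1)},\dots,U^{(d)})$ is a unitarily semi-nondegenerate point of $f$ if, for every $i$, $U^{(i)}$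 is a unitarily semi-nondegenerate point of the restricted function $h_{(i)}(U)=f(U^{(1)},\dots,U^{(i-1)},U,U^{(i+1)},\dots,U^{(d)})$ on $\mathrm{St}(r,n_i,\mathbb{C})$. *)

theory Defs
  imports Complex_Main "Jordan_Normal_Form.Schur_Decomposition" "Jordan_Normal_Form.VS_Connect"
    "HOL-Library.FuncSet"
begin

section \<open>Tensors\<close>

text \<open>
  A complex tensor of format \<open>n 0 \<times> \<dots> \<times> n (d - 1)\<close> is a function on the multi-indices
  in \<open>tensor_idx d n\<close>; its values elsewhere are irrelevant.  Modes and indices are counted from 0.
\<close>

type_synonym ctensor = "(nat \<Rightarrow> nat) \<Rightarrow> complex"

definition tensor_idx :: "nat \<Rightarrow> (nat \<Rightarrow> nat) \<Rightarrow> (nat \<Rightarrow> nat) set" where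
  "tensor_idx d n = (\<Pi>\<^sub>E i\<in>{..<d}. {..<n i})"

definition diag_idx :: "nat \<Rightarrow> nat \<Rightarrow> (nat \<Rightarrow> nat)" where
  "diag_idx d p = (\<lambda>i\<in>{..<d}. p)"

definition diagonal_tensor :: "nat \<Rightarrow> (nat \<Rightarrow> nat) \<Rightarrow> ctensor \<Rightarrow> bool" where
  "diagonal_tensor d n A \<longleftrightarrow> (\<forall>p\<in>tensor_idx d n. A p \<noteq> 0 \<longrightarrow> (\<exists>k. p = diag_idx d k))"

definition frobenius_norm :: "nat \<Rightarrow> (nat \<Rightarrow> nat) \<Rightarrow> ctensor \<Rightarrow> real" where
  "frobenius_norm d n A = sqrt (\<Sum>p\<in>tensor_idx d n. (cmod (A p))\<^sup>2)"

definition mode_prod :: "ctensor \<Rightarrow> nat \<Rightarrow> complex mat \<Rightarrow> ctensor" where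
  "mode_prod A i X = (\<lambda>p. \<Sum>k<dim_col X. A (p(i := k)) * X $$ (p i, k))"

text \<open>\<open>A \<bullet>\<^sub>0 X 0 \<bullet>\<^sub>1 X 1 \<dots>\<close>, the products being taken from left to right.\<close>

definition multi_mode_prod :: "nat \<Rightarrow> ctensor \<Rightarrow> (nat \<Rightarrow> complex mat) \<Rightarrow> ctensor" where
  "multi_mode_prod d A X = fold (\<lambda>i B. mode_prod B i (X i)) [0..<d] A"

definition rect_id :: "nat \<Rightarrow> nat \<Rightarrow> complex mat" where
  "rect_id n r = mat n r (\<lambda>(i, j). if i = j then 1 else 0)"

text \<open>The parameter \<open>dag\<close> stands for the transpose or the conjugate transpose.\<close>

definition objective ::
  "nat \<Rightarrow> nat \<Rightarrow> nat \<Rightarrow> (complex mat \<Rightarrow> complex mat) \<Rightarrow> (nat \<Rightarrow> real) \<Rightarrow> (nat \<Rightarrow> ctensor)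
    \<Rightarrow> (nat \<Rightarrow> complex mat) \<Rightarrow> real" where
  "objective d r L dag \<alpha> A U =
    (\<Sum>l<L. \<alpha> l * (frobenius_norm d (\<lambda>_. r) (multi_mode_prod d (A l) (\<lambda>i. dag (U i))))\<^sup>2)"

section \<open>The Stiefel manifold as a Riemannian submanifold\<close>

definition stiefel :: "nat \<Rightarrow> nat \<Rightarrow> complex mat set" where
  "stiefel r n = {X \<in> carrier_mat n r. mat_adjoint X * X = 1\<^sub>m r}"

definition re_inner :: "complex mat \<Rightarrow> complex mat \<Rightarrow> real" where
  "re_inner X Y = Re (\<Sum>j<dim_col X. (mat_adjoint X * Y) $$ (j, j))"

definition has_mat_derivative ::
  "nat \<Rightarrow> nat \<Rightarrow> (real \<Rightarrow> complex mat) \<Rightarrow> complex mat \<Rightarrow> real \<Rightarrow> bool" where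
  "has_mat_derivative n r \<gamma> Z t \<longleftrightarrow> Z \<in> carrier_mat n r \<and>
    (\<forall>i<n. \<forall>j<r. ((\<lambda>s. \<gamma> s $$ (i, j)) has_vector_derivative Z $$ (i, j)) (at t))"

text \<open>
  Curves are only required to be differentiable at the base point.  This gives the same velocities
  as smooth curves do, while differentiability of a function along all these curves (with
  derivative linear in the velocity) is Frechet differentiability on the submanifold.
\<close>

definition stiefel_curve ::
  "nat \<Rightarrow> nat \<Rightarrow> complex mat \<Rightarrow> (real \<Rightarrow> complex mat) \<Rightarrow> complex mat \<Rightarrow> bool" where
  "stiefel_curve r n U \<gamma> Z \<longleftrightarrow>
    (\<forall>t. \<gamma> t \<in> stiefel r n) \<and> \<gamma> 0 = U \<and> has_mat_derivative n r \<gamma> Z 0"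

definition tangent_space :: "nat \<Rightarrow> nat \<Rightarrow> complex mat \<Rightarrow> complex mat set" where
  "tangent_space r n U = {Z. \<exists>\<gamma>. stiefel_curve r n U \<gamma> Z}"

text \<open>A set \<open>W\<close> of complex \<open>n \<times> r\<close> matrices as a module over the reals.\<close>

definition real_mat_module :: "nat \<Rightarrow> nat \<Rightarrow> complex mat set \<Rightarrow> (real, complex mat) module" where
  "real_mat_module n r W = \<lparr>
    carrier = W,
    monoid.mult = (*),
    one = 1\<^sub>m n,
    zero = 0\<^sub>m n r,
    add = (+),
    module.smult = (\<lambda>a A. complex_of_real a \<cdot>\<^sub>m A)\<rparr>"

definition has_riem_gradient ::
  "nat \<Rightarrow> nat \<Rightarrow> (complex mat \<Rightarrow> real) \<Rightarrow> complex mat \<Rightarrow> complex mat \<Rightarrow> bool" where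
  "has_riem_gradient r n h U G \<longleftrightarrow> G \<in> tangent_space r n U \<and>
    (\<forall>\<gamma> Z. stiefel_curve r n U \<gamma> Z \<longrightarrow>
      ((\<lambda>t. h (\<gamma> t)) has_real_derivative re_inner G Z) (at 0))"

definition is_tangent_proj ::
  "nat \<Rightarrow> nat \<Rightarrow> complex mat \<Rightarrow> complex mat \<Rightarrow> complex mat \<Rightarrow> bool" where
  "is_tangent_proj r n U V P \<longleftrightarrow> P \<in> tangent_space r n U \<and>
    (\<forall>Y\<in>tangent_space r n U. re_inner (V - P) Y = 0)"

text \<open>
  The Levi-Civita connection of a Riemannian submanifold of a Euclidean space is the tangential
  part of the ambient derivative; so the Hessian at \<open>U\<close> in direction \<open>Z\<close> is the
  orthogonal projection onto the tangent space at \<open>U\<close> of the derivative of the gradient field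
  along a curve through \<open>U\<close> with velocity \<open>Z\<close>.
\<close>

definition has_riem_hessian ::
  "nat \<Rightarrow> nat \<Rightarrow> (complex mat \<Rightarrow> real) \<Rightarrow> complex mat \<Rightarrow> (complex mat \<Rightarrow> complex mat) \<Rightarrow> bool" where
  "has_riem_hessian r n h U H \<longleftrightarrow>
    linear_map class_ring (real_mat_module n r (tangent_space r n U))
      (real_mat_module n r (tangent_space r n U)) H \<and>
    (\<exists>grad. (\<forall>X\<in>stiefel r n. has_riem_gradient r n h X (grad X)) \<and>
      (\<forall>\<gamma> Z. stiefel_curve r n U \<gamma> Z \<longrightarrow>
        (\<exists>V. has_mat_derivative n r (\<lambda>t. grad (\<gamma> t)) V 0 \<and> is_tangent_proj r n U V (H Z))))"

definition real_rank_on_tangent ::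
  "nat \<Rightarrow> nat \<Rightarrow> complex mat \<Rightarrow> (complex mat \<Rightarrow> complex mat) \<Rightarrow> nat" where
  "real_rank_on_tangent r n U H =
    vectorspace.dim class_ring (real_mat_module n r (H ` tangent_space r n U))"

section \<open>Unitarily semi-nondegenerate points\<close>

definition unitarily_invariant :: "nat \<Rightarrow> nat \<Rightarrow> (complex mat \<Rightarrow> real) \<Rightarrow> bool" where
  "unitarily_invariant r n h \<longleftrightarrow>
    (\<forall>U\<in>stiefel r n. \<forall>R\<in>carrier_mat r r. mat_adjoint R * R = 1\<^sub>m r \<longrightarrow> h (U * R) = h U)"

definition unitarily_semi_nondegenerate ::
  "nat \<Rightarrow> nat \<Rightarrow> (complex mat \<Rightarrow> real) \<Rightarrow> complex mat \<Rightarrow> bool" where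
  "unitarily_semi_nondegenerate r n h U \<longleftrightarrow>
    U \<in> stiefel r n \<and>
    unitarily_invariant r n h \<and>
    has_riem_gradient r n h U (0\<^sub>m n r) \<and>
    (\<exists>H. has_riem_hessian r n h U H \<and> real_rank_on_tangent r n U H = 2 * r * (n - r))"

definition unitarily_semi_nondegenerate_prod ::
  "nat \<Rightarrow> nat \<Rightarrow> (nat \<Rightarrow> nat) \<Rightarrow> ((nat \<Rightarrow> complex mat) \<Rightarrow> real) \<Rightarrow> (nat \<Rightarrow> complex mat) \<Rightarrow> bool" where
  "unitarily_semi_nondegenerate_prod d r n f \<omega> \<longleftrightarrow>
    (\<forall>i<d. unitarily_semi_nondegenerate r (n i) (\<lambda>U. f (\<omega>(i := U))) (\<omega> i))"

end

theory Submission
  imports Defs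
begin

text \<open>
  Fix all factors but the one in mode \<open>i\<close> at \<open>Q\<^sub>j I\<close>.  These factors cancel the rotations \<open>Q\<^sub>j\<close> in the
  tensors, so what remains is the diagonal tensor multiplied in a single mode, and as \<open>d > 1\<close> its
  entries do not interfere.  With \<open>\<beta>\<^sub>k = \<Sum>\<^sub>l \<alpha>\<^sub>l |D\<^sub>l (k, \<dots>, k)|\<^sup>2\<close> the restricted function is therefore
  the weighted sum \<open>\<Sum>\<^sub>k \<beta>\<^sub>k |(Q\<^sub>i\<^sup>H X)\<^sub>k|\<^sup>2\<close> over the first \<open>r\<close> rows of \<open>Q\<^sub>i\<^sup>H X\<close>
  (\<open>objective_restricted\<close>).  In other words it is the Hermitian quadratic form \<open>tr (X\<^sup>H S X)\<close> with
  \<open>S = U B U\<^sup>H\<close>, \<open>U = Q\<^sub>i I\<close> and \<open>B = diag (\<beta>\<^sub>0, \<dots>, \<beta>\<^sub>r\<^sub>-\<^sub>1)\<close> (\<open>re_inner_leading_columns\<close>).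

  Such a form is unitarily invariant.  Its Riemannian gradient at \<open>X\<close> is \<open>2 (1 - X X\<^sup>H) S X\<close>
  (\<open>quadratic_gradient_correct\<close>), which vanishes at \<open>U\<close> because \<open>S U = U B\<close>.  Since moreover
  \<open>(1 - U U\<^sup>H) S = 0\<close>, the derivative of the gradient at \<open>U\<close> in direction \<open>Z\<close> is
  \<open>- 2 (1 - U U\<^sup>H) Z B\<close> (\<open>quadratic_gradient_derivative_eigen\<close>).  This is the Hessian; for \<open>r < n\<^sub>i\<close>
  the matrix \<open>B\<close> is invertible by assumption, and the image is the space of all \<open>Y\<close> with \<open>U\<^sup>H Y = 0\<close>,
  of real dimension \<open>2 r (n\<^sub>i - r)\<close> (\<open>eigen_hessian_image\<close>, \<open>dim_lower_rows\<close>).  For \<open>r = n\<^sub>i\<close> both the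
  Hessian and this space are zero.

  All of this rests on the description of the tangent space at \<open>X\<close> as the set of \<open>Z\<close> with \<open>X\<^sup>H Z\<close>
  skew-Hermitian (\<open>tangent_space_eq\<close>).  The difficult inclusion asks for a curve in the Stiefel
  manifold with the given velocity, which the Cayley transform supplies.
\<close>

section \<open>Adjoints and matrix arithmetic\<close>

lemma dim_row_adjoint [simp]: "dim_row (mat_adjoint A) = dim_col A"
  and dim_col_adjoint [simp]: "dim_col (mat_adjoint A) = dim_row A"
  unfolding mat_adjoint_def by simp_all

lemma adjoint_carrier_iff [simp]: "mat_adjoint A \<in> carrier_mat n m \<longleftrightarrow> A \<in> carrier_mat m n"
  unfolding carrier_mat_def by auto

lemma index_adjoint [simp]:
  fixes A :: "complex mat"
  shows "i < dim_col A \<Longrightarrow> j < dim_row A \<Longrightarrow> mat_adjoint A $$ (i, j) = cnj (A $$ (j, i))"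
  unfolding mat_adjoint_def by (simp add: mat_of_rows_index)

lemma index_mult_sum:
  "i < dim_row A \<Longrightarrow> j < dim_col B \<Longrightarrow> dim_col A = dim_row B \<Longrightarrow>
    (A * B) $$ (i, j) = (\<Sum>k<dim_row B. A $$ (i, k) * B $$ (k, j))"
  by (simp add: scalar_prod_def lessThan_atLeast0)

text \<open>
  The ring laws are needed with equations between dimensions as side conditions: unlike membership
  in \<^const>\<open>carrier_mat\<close> with unknown indices, the simplifier can discharge these for compound
  terms.
\<close>

lemma mult_assoc_dim:
  fixes A :: "complex mat"
  shows "dim_col A = dim_row B \<Longrightarrow> dim_col B = dim_row C \<Longrightarrow> A * B * C = A * (B * C)"
  by (rule assoc_mult_mat[OF carrier_matI carrier_matI carrier_matI]) simp_all

lemma mult_add_dim: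
  fixes A :: "complex mat"
  shows "dim_col A = dim_row B \<Longrightarrow> dim_row B = dim_row C \<Longrightarrow> dim_col B = dim_col C \<Longrightarrow>
    A * (B + C) = A * B + A * C"
  by (rule mult_add_distrib_mat[OF carrier_matI carrier_matI carrier_matI]) simp_all

lemma add_mult_dim:
  fixes A :: "complex mat"
  shows "dim_col B = dim_row C \<Longrightarrow> dim_row A = dim_row B \<Longrightarrow> dim_col A = dim_col B \<Longrightarrow>
    (A + B) * C = A * C + B * C"
  by (rule add_mult_distrib_mat[OF carrier_matI carrier_matI carrier_matI]) simp_all

lemma mult_minus_dim:
  fixes A :: "complex mat"
  shows "dim_col A = dim_row B \<Longrightarrow> dim_row B = dim_row C \<Longrightarrow> dim_col B = dim_col C \<Longrightarrow>
    A * (B - C) = A * B - A * C"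
  by (rule mult_minus_distrib_mat[OF carrier_matI carrier_matI carrier_matI]) simp_all

lemma minus_mult_dim:
  fixes A :: "complex mat"
  shows "dim_col B = dim_row C \<Longrightarrow> dim_row A = dim_row B \<Longrightarrow> dim_col A = dim_col B \<Longrightarrow>
    (A - B) * C = A * C - B * C"
  by (rule minus_mult_distrib_mat[OF carrier_matI carrier_matI carrier_matI]) simp_all

lemma mult_smult_dim:
  fixes A :: "complex mat"
  shows "dim_col A = dim_row B \<Longrightarrow> A * (c \<cdot>\<^sub>m B) = c \<cdot>\<^sub>m (A * B)"
  by (rule mult_smult_distrib[OF carrier_matI carrier_matI]) simp_all

lemma smult_mult_dim:
  fixes A :: "complex mat"
  shows "dim_col A = dim_row B \<Longrightarrow> (c \<cdot>\<^sub>m A) * B = c \<cdot>\<^sub>m (A * B)"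
  by (rule mult_smult_assoc_mat[OF carrier_matI carrier_matI]) simp_all

lemmas mat_ring_simps =
  mult_assoc_dim mult_add_dim add_mult_dim mult_minus_dim minus_mult_dim mult_smult_dim smult_mult_dim

lemma adjoint_adjoint [simp]: "mat_adjoint (mat_adjoint A) = (A :: complex mat)"
  by (rule eq_matI) auto

lemma adjoint_mult:
  fixes A :: "complex mat"
  assumes "dim_col A = dim_row B"
  shows "mat_adjoint (A * B) = mat_adjoint B * mat_adjoint A"
  using assms by (intro eq_matI) (auto simp: index_mult_sum mult.commute simp del: index_mult_mat(1))

lemma adjoint_add:
  fixes A :: "complex mat"
  assumes "dim_row A = dim_row B" "dim_col A = dim_col B"
  shows "mat_adjoint (A + B) = mat_adjoint A + mat_adjoint B"
  using assms by (intro eq_matI) auto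

lemma adjoint_minus:
  fixes A :: "complex mat"
  assumes "dim_row A = dim_row B" "dim_col A = dim_col B"
  shows "mat_adjoint (A - B) = mat_adjoint A - mat_adjoint B"
  using assms by (intro eq_matI) auto

lemma adjoint_uminus: "mat_adjoint (- A) = - mat_adjoint (A :: complex mat)"
  by (rule eq_matI) auto

lemma adjoint_smult: "mat_adjoint (c \<cdot>\<^sub>m A) = cnj c \<cdot>\<^sub>m mat_adjoint (A :: complex mat)"
  by (rule eq_matI) auto

lemmas adjoint_simps = adjoint_mult adjoint_add adjoint_minus adjoint_uminus adjoint_smult

section \<open>The real inner product of complex matrices\<close>

lemma re_inner_sum:
  assumes "dim_row X = dim_row Y" "dim_col X = dim_col Y"
  shows "re_inner X Y = (\<Sum>j<dim_col Y. \<Sum>i<dim_row Y. Re (cnj (X $$ (i, j)) * Y $$ (i, j)))"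
  using assms unfolding re_inner_def
  by (auto simp: index_mult_sum simp del: index_mult_mat(1) intro!: sum.cong)

lemma re_inner_commute:
  assumes "dim_row X = dim_row Y" "dim_col X = dim_col Y"
  shows "re_inner X Y = re_inner Y X"
  using assms by (simp add: re_inner_sum algebra_simps)

lemma re_inner_minus_left:
  assumes "dim_row X = dim_row Z" "dim_col X = dim_col Z" "dim_row Y = dim_row Z" "dim_col Y = dim_col Z"
  shows "re_inner (X - Y) Z = re_inner X Z - re_inner Y Z"
  using assms by (simp add: re_inner_sum left_diff_distrib right_diff_distrib sum.distrib sum_subtractf)

lemma re_inner_uminus_right:
  assumes "dim_row X = dim_row Y" "dim_col X = dim_col Y"
  shows "re_inner X (- Y) = - re_inner X Y"
  using assms by (simp add: re_inner_sum sum.distrib sum_subtractf sum_negf)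

lemma re_inner_smult_left:
  assumes "dim_row X = dim_row Y" "dim_col X = dim_col Y"
  shows "re_inner (complex_of_real c \<cdot>\<^sub>m X) Y = c * re_inner X Y"
  using assms by (simp add: re_inner_sum sum_distrib_left algebra_simps)

text \<open>Cyclicity of the trace: left and right multiplications are moved across by adjoints.\<close>

lemma re_inner_mult_left:
  assumes "dim_col A = dim_row X" "dim_row A = dim_row Y" "dim_col X = dim_col Y"
  shows "re_inner (A * X) Y = re_inner X (mat_adjoint A * Y)"
  using assms unfolding re_inner_def by (simp add: adjoint_mult mult_assoc_dim)

lemma re_inner_adjoint:
  assumes "dim_row X = dim_row Y" "dim_col X = dim_col Y"
  shows "re_inner (mat_adjoint X) (mat_adjoint Y) = re_inner X Y"
proof -
  have "re_inner (mat_adjoint X) (mat_adjoint Y)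
      = (\<Sum>j<dim_row Y. \<Sum>i<dim_col Y. Re (cnj (X $$ (j, i)) * Y $$ (j, i)))"
    using assms by (auto simp: re_inner_sum algebra_simps intro!: sum.cong)
  also have "\<dots> = re_inner X Y"
    unfolding re_inner_sum[OF assms] by (rule sum.swap)
  finally show ?thesis .
qed

lemma re_inner_mult_right:
  assumes "dim_col X = dim_row A" "dim_col A = dim_col Y" "dim_row X = dim_row Y"
  shows "re_inner (X * A) Y = re_inner A (mat_adjoint X * Y)"
  using assms by (simp add: re_inner_mult_left)

text \<open>
  \<open>Re tr\<close> is invariant under taking adjoints, which fixes \<open>M\<close> and negates \<open>K\<close>.  This is what makes
  \<open>X M\<close> with \<open>M\<close> Hermitian a normal vector of the Stiefel manifold at \<open>X\<close>.
\<close>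

lemma re_inner_hermitian_skew:
  assumes "mat_adjoint M = M" "mat_adjoint K = - K" "dim_row M = dim_row K" "dim_col M = dim_col K"
  shows "re_inner M K = 0"
  using re_inner_adjoint[OF assms(3,4)] re_inner_uminus_right[OF assms(3,4)] assms(1,2) by simp

section \<open>Derivatives of matrix-valued curves\<close>

lemma has_mat_derivativeD:
  "has_mat_derivative n r \<gamma> Z t \<Longrightarrow> i < n \<Longrightarrow> j < r \<Longrightarrow>
    ((\<lambda>s. \<gamma> s $$ (i, j)) has_vector_derivative Z $$ (i, j)) (at t)"
  unfolding has_mat_derivative_def by blast

lemma has_mat_derivative_dims:
  assumes "has_mat_derivative n r \<gamma> Z t"
  shows "dim_row Z = n" "dim_col Z = r"
  using assms unfolding has_mat_derivative_def by auto

lemma has_mat_derivative_const: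
  "C \<in> carrier_mat n r \<Longrightarrow> has_mat_derivative n r (\<lambda>_. C) (0\<^sub>m n r) t"
  unfolding has_mat_derivative_def by auto

lemma has_mat_derivative_minus:
  assumes "has_mat_derivative n r \<gamma> Y t" "has_mat_derivative n r \<eta> Z t"
    and "\<And>s. \<gamma> s \<in> carrier_mat n r" "\<And>s. \<eta> s \<in> carrier_mat n r"
  shows "has_mat_derivative n r (\<lambda>s. \<gamma> s - \<eta> s) (Y - Z) t"
proof -
  have d: "dim_row (\<gamma> s) = n" "dim_col (\<gamma> s) = r" "dim_row (\<eta> s) = n" "dim_col (\<eta> s) = r" for s
    using assms(3,4)[of s] by auto
  show ?thesis
    using assms(1,2) unfolding has_mat_derivative_def
    by (auto simp: d intro!: has_vector_derivative_diff)
qed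

lemma has_mat_derivative_smult:
  assumes "has_mat_derivative n r \<gamma> Z t" "\<And>s. \<gamma> s \<in> carrier_mat n r"
  shows "has_mat_derivative n r (\<lambda>s. c \<cdot>\<^sub>m \<gamma> s) (c \<cdot>\<^sub>m Z) t"
proof -
  have d: "dim_row (\<gamma> s) = n" "dim_col (\<gamma> s) = r" for s
    using assms(2)[of s] by auto
  show ?thesis
    using assms(1) unfolding has_mat_derivative_def
    by (auto simp: d intro!: bounded_linear.has_vector_derivative[OF bounded_linear_mult_right])
qed

lemma has_mat_derivative_adjoint:
  assumes "has_mat_derivative n r \<gamma> Z t" "\<And>s. \<gamma> s \<in> carrier_mat n r"
  shows "has_mat_derivative r n (\<lambda>s. mat_adjoint (\<gamma> s)) (mat_adjoint Z) t"
proof -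
  have d: "dim_row (\<gamma> s) = n" "dim_col (\<gamma> s) = r" for s
    using assms(2)[of s] by auto
  show ?thesis
    using assms(1) unfolding has_mat_derivative_def
    by (auto simp: d intro!: has_vector_derivative_cnj)
qed

lemma has_mat_derivative_mult:
  assumes \<gamma>: "has_mat_derivative n m \<gamma> Y t" and \<eta>: "has_mat_derivative m r \<eta> Z t"
    and c\<gamma>: "\<And>s. \<gamma> s \<in> carrier_mat n m" and c\<eta>: "\<And>s. \<eta> s \<in> carrier_mat m r"
  shows "has_mat_derivative n r (\<lambda>s. \<gamma> s * \<eta> s) (\<gamma> t * Z + Y * \<eta> t) t"
proof -
  have d: "dim_row (\<gamma> s) = n" "dim_col (\<gamma> s) = m" "dim_row (\<eta> s) = m" "dim_col (\<eta> s) = r" for s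
    by (simp_all only: carrier_matD[OF c\<gamma>] carrier_matD[OF c\<eta>])
  have dY: "dim_row Y = n" "dim_col Y = m" and dZ: "dim_row Z = m" "dim_col Z = r"
    by (simp_all only: has_mat_derivative_dims[OF \<gamma>] has_mat_derivative_dims[OF \<eta>])
  have "((\<lambda>s. (\<gamma> s * \<eta> s) $$ (i, j)) has_vector_derivative (\<gamma> t * Z + Y * \<eta> t) $$ (i, j)) (at t)"
    if "i < n" "j < r" for i j
  proof -
    have "((\<lambda>s. \<Sum>k<m. \<gamma> s $$ (i, k) * \<eta> s $$ (k, j)) has_vector_derivative
        (\<Sum>k<m. \<gamma> t $$ (i, k) * Z $$ (k, j) + Y $$ (i, k) * \<eta> t $$ (k, j))) (at t)"
      by (intro has_vector_derivative_sum has_vector_derivative_mult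
          has_mat_derivativeD[OF \<gamma>] has_mat_derivativeD[OF \<eta>]) (use that in auto)
    then show ?thesis
      using that
      by (simp add: d dY dZ index_mult_sum sum.distrib del: index_mult_mat(1))
  qed
  moreover have "\<gamma> t * Z + Y * \<eta> t \<in> carrier_mat n r"
    by (rule carrier_matI) (simp_all add: d dY dZ)
  ultimately show ?thesis
    unfolding has_mat_derivative_def by blast
qed

lemma has_mat_derivative_unique:
  assumes "has_mat_derivative n r \<gamma> Y t" "has_mat_derivative n r \<gamma> Z t"
  shows "Y = Z"
proof (rule eq_matI)
  fix i j assume "i < dim_row Z" "j < dim_col Z"
  then have "i < n" "j < r" by (simp_all add: has_mat_derivative_dims[OF assms(2)])
  note D = assms[THEN has_mat_derivativeD, OF this]
  have "Re (Y $$ (i, j)) = Re (Z $$ (i, j))" "Im (Y $$ (i, j)) = Im (Z $$ (i, j))"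
    by (rule DERIV_unique[OF D[THEN has_field_derivative_Re]],
        rule DERIV_unique[OF D[THEN has_field_derivative_Im]])
  then show "Y $$ (i, j) = Z $$ (i, j)"
    by (rule complex_eqI)
qed (simp_all only: assms[THEN has_mat_derivative_dims(1)] assms[THEN has_mat_derivative_dims(2)])

lemma re_inner_has_derivative:
  assumes \<gamma>: "has_mat_derivative n r \<gamma> Y t" and \<eta>: "has_mat_derivative n r \<eta> Z t"
    and c\<gamma>: "\<And>s. \<gamma> s \<in> carrier_mat n r" and c\<eta>: "\<And>s. \<eta> s \<in> carrier_mat n r"
  shows "((\<lambda>s. re_inner (\<gamma> s) (\<eta> s)) has_real_derivative
    re_inner (\<gamma> t) Z + re_inner Y (\<eta> t)) (at t)"
proof -
  have d: "dim_row (\<gamma> s) = n" "dim_col (\<gamma> s) = r" "dim_row (\<eta> s) = n" "dim_col (\<eta> s) = r" for s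
    by (simp_all only: carrier_matD[OF c\<gamma>] carrier_matD[OF c\<eta>])
  have dYZ: "dim_row Y = n" "dim_col Y = r" "dim_row Z = n" "dim_col Z = r"
    by (simp_all only: has_mat_derivative_dims[OF \<gamma>] has_mat_derivative_dims[OF \<eta>])
  have "((\<lambda>s. \<Sum>j<r. \<Sum>i<n. Re (cnj (\<gamma> s $$ (i, j)) * \<eta> s $$ (i, j))) has_real_derivative
      (\<Sum>j<r. \<Sum>i<n. Re (cnj (\<gamma> t $$ (i, j)) * Z $$ (i, j) + cnj (Y $$ (i, j)) * \<eta> t $$ (i, j)))) (at t)"
    by (intro DERIV_sum has_field_derivative_Re has_vector_derivative_mult has_vector_derivative_cnj
        has_mat_derivativeD[OF \<gamma>] has_mat_derivativeD[OF \<eta>]) auto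
  then show ?thesis
    by (simp add: re_inner_sum d dYZ sum.distrib)
qed

section \<open>The tangent space of the Stiefel manifold\<close>

lemma stiefel_dims:
  assumes "U \<in> stiefel r n"
  shows "dim_row U = n" "dim_col U = r"
  using assms unfolding stiefel_def by auto

lemma stiefelD:
  assumes "U \<in> stiefel r n"
  shows "U \<in> carrier_mat n r" "mat_adjoint U * U = 1\<^sub>m r"
  using assms unfolding stiefel_def by auto

lemma stiefelI:
  "dim_row U = n \<Longrightarrow> dim_col U = r \<Longrightarrow> mat_adjoint U * U = 1\<^sub>m r \<Longrightarrow> U \<in> stiefel r n"
  unfolding stiefel_def by blast

lemma stiefel_entry_le_1:
  assumes "U \<in> stiefel r n" "i < n" "j < r"
  shows "cmod (U $$ (i, j)) \<le> 1"
proof -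
  note [simp] = stiefel_dims[OF assms(1)]
  have "(\<Sum>k<n. cnj (U $$ (k, j)) * U $$ (k, j)) = (mat_adjoint U * U) $$ (j, j)"
    using assms by (simp add: index_mult_sum del: index_mult_mat(1))
  also have "\<dots> = 1"
    using assms by (simp add: stiefelD(2))
  finally have "complex_of_real (\<Sum>k<n. (cmod (U $$ (k, j)))\<^sup>2) = complex_of_real 1"
    by (simp add: complex_norm_square mult.commute del: of_real_power)
  then have "(\<Sum>k<n. (cmod (U $$ (k, j)))\<^sup>2) = 1"
    by (simp only: of_real_eq_iff)
  moreover have "(cmod (U $$ (i, j)))\<^sup>2 \<le> (\<Sum>k<n. (cmod (U $$ (k, j)))\<^sup>2)"
    using assms by (intro member_le_sum) auto
  ultimately show ?thesis
    using abs_square_le_1[of "cmod (U $$ (i, j))"] by simp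
qed

lemma re_inner_self_eq_0D:
  assumes "re_inner X X = 0" "i < dim_row X" "j < dim_col X"
  shows "X $$ (i, j) = 0"
proof -
  have "(\<Sum>j<dim_col X. \<Sum>i<dim_row X. (cmod (X $$ (i, j)))\<^sup>2) = 0"
    using assms(1) by (simp add: re_inner_sum cmod_power2 power2_eq_square[symmetric])
  then have "(\<Sum>i<dim_row X. (cmod (X $$ (i, j)))\<^sup>2) = 0"
    using assms(3) by (subst (asm) sum_nonneg_eq_0_iff) (auto intro: sum_nonneg)
  then show ?thesis
    using assms(2) by (subst (asm) sum_nonneg_eq_0_iff) auto
qed

text \<open>
  Real numbers are no eigenvalues of a skew-Hermitian matrix except for 0, so \<open>1 - K\<close> is
  invertible and the Cayley transform \<open>(1 - K)\<inverse> (1 + K)\<close> exists.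
\<close>

lemma cayley_transform_exists:
  fixes K :: "complex mat"
  assumes K: "K \<in> carrier_mat n n" "mat_adjoint K = - K" and X: "X \<in> carrier_mat n r"
  shows "\<exists>Y\<in>carrier_mat n r. Y - X = K * (Y + X)"
proof -
  have [simp]: "dim_row K = n" "dim_col K = n" "dim_row X = n" "dim_col X = r"
    using K X by auto
  have M: "1\<^sub>m n - K \<in> carrier_mat n n"
    by (rule carrier_matI) simp_all
  have "det (1\<^sub>m n - K) \<noteq> 0"
  proof
    assume "det (1\<^sub>m n - K) = 0"
    then obtain v where v: "v \<in> carrier_vec n" "v \<noteq> 0\<^sub>v n" "(1\<^sub>m n - K) *\<^sub>v v = 0\<^sub>v n"
      using det_0_iff_vec_prod_zero_field[OF M] by auto
    have [simp]: "dim_vec v = n" using v(1) by simp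
    define V where "V = mat n 1 (\<lambda>(i, _). v $ i)"
    have [simp]: "dim_row V = n" "dim_col V = 1" by (simp_all add: V_def)
    have KV: "K * V = V"
    proof (rule eq_matI)
      fix i j assume "i < dim_row V" "j < dim_col V"
      then have ij: "i < n" "j = 0" by simp_all
      have "((1\<^sub>m n - K) *\<^sub>v v) $ i = v $ i - (\<Sum>k<n. K $$ (i, k) * v $ k)"
        using ij by (simp add: scalar_prod_def lessThan_atLeast0 left_diff_distrib sum_subtractf
            if_distrib[of "\<lambda>x. x * _"] cong: if_cong)
      then show "(K * V) $$ (i, j) = V $$ (i, j)"
        using ij v(3) by (simp add: index_mult_sum V_def del: index_mult_mat(1))
    qed simp_all
    have "re_inner V V = re_inner V (mat_adjoint K * V)"
      using re_inner_mult_left[of K V V] KV by simp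
    also have "\<dots> = - re_inner V V"
      by (simp add: K(2) KV re_inner_uminus_right)
    finally have "re_inner V V = 0" by simp
    then have "V $$ (i, 0) = 0" if "i < n" for i
      using re_inner_self_eq_0D[of V i 0] that by simp
    then have "v = 0\<^sub>v n"
      by (intro eq_vecI) (simp_all add: V_def)
    with v(2) show False ..
  qed
  from det_non_zero_imp_unit[OF M this, of "()"]
  obtain N where N: "N \<in> carrier_mat n n" "(1\<^sub>m n - K) * N = 1\<^sub>m n"
    unfolding Units_def ring_mat_def by auto
  have [simp]: "dim_row N = n" "dim_col N = n" using N by auto
  define Y where "Y = N * (X + K * X)"
  have [simp]: "dim_row Y = n" "dim_col Y = r" by (simp_all add: Y_def)
  have "Y - K * Y = (1\<^sub>m n - K) * Y"
    by (simp add: minus_mult_dim)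
  also have "\<dots> = (1\<^sub>m n - K) * N * (X + K * X)"
    by (simp add: Y_def mult_assoc_dim)
  finally have *: "Y - K * Y = X + K * X"
    by (simp add: N(2))
  have "Y - X = K * (Y + X)"
  proof (rule eq_matI)
    fix i j assume "i < dim_row (K * (Y + X))" "j < dim_col (K * (Y + X))"
    then show "(Y - X) $$ (i, j) = (K * (Y + X)) $$ (i, j)"
      using arg_cong[OF *, of "\<lambda>M. M $$ (i, j)"]
      by (simp add: mult_add_dim algebra_simps del: index_mult_mat(1))
  qed simp_all
  then show ?thesis by (intro bexI[of _ Y] carrier_matI) simp_all
qed

text \<open>
  The polarisation \<open>2 (Y\<^sup>H Y - X\<^sup>H X) = (Y - X)\<^sup>H (Y + X) + (Y + X)\<^sup>H (Y - X)\<close> shows that the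
  Cayley transform preserves the Gram matrix.
\<close>

lemma cayley_transform_isometric:
  fixes K :: "complex mat"
  assumes K: "K \<in> carrier_mat n n" "mat_adjoint K = - K"
    and X: "X \<in> carrier_mat n r" and Y: "Y \<in> carrier_mat n r"
    and eq: "Y - X = K * (Y + X)"
  shows "mat_adjoint Y * Y = mat_adjoint X * X"
proof (rule eq_matI)
  have [simp]: "dim_row K = n" "dim_col K = n" "dim_row X = n" "dim_col X = r"
      "dim_row Y = n" "dim_col Y = r"
    using K X Y by auto
  fix i j assume "i < dim_row (mat_adjoint X * X)" "j < dim_col (mat_adjoint X * X)"
  then have [simp]: "i < r" "j < r" by simp_all
  let ?S = "Y + X"
  have "mat_adjoint (Y - X) * ?S = - (mat_adjoint ?S * (Y - X))"
    unfolding eq by (simp add: adjoint_mult mult_assoc_dim K(2))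
  from arg_cong[OF this, of "\<lambda>M. M $$ (i, j)"]
  show "(mat_adjoint Y * Y) $$ (i, j) = (mat_adjoint X * X) $$ (i, j)"
    by (simp add: adjoint_simps mat_ring_simps del: index_mult_mat(1))
qed (use X Y in simp_all)

lemma has_vector_derivative_caratheodory:
  fixes f g :: "real \<Rightarrow> complex"
  assumes eq: "\<And>t. f t - f a = (t - a) *\<^sub>R g t" and g: "isCont g a"
  shows "(f has_vector_derivative g a) (at a)"
proof -
  have "DERIV (\<lambda>t. Re (f t)) a :> Re (g a)"
    unfolding CARAT_DERIV
    using arg_cong[OF eq, of Re] g by (intro exI[of _ "\<lambda>t. Re (g t)"]) (simp add: mult.commute)
  moreover have "DERIV (\<lambda>t. Im (f t)) a :> Im (g a)"
    unfolding CARAT_DERIV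
    using arg_cong[OF eq, of Im] g by (intro exI[of _ "\<lambda>t. Im (g t)"]) (simp add: mult.commute)
  ultimately show ?thesis
    by (simp add: has_vector_derivative_complex_iff)
qed

text \<open>
  A curve with velocity \<open>W X\<close>: take the Cayley transforms of \<open>t W / 2\<close>.  They are only determined
  implicitly by \<open>\<gamma> t - X = t / 2 W (\<gamma> t + X)\<close>, but since the entries of \<open>\<gamma> t\<close> are bounded by 1, this
  equation first gives continuity at 0 and then the derivative.
\<close>

lemma stiefel_curve_skew:
  assumes X: "X \<in> stiefel r n" and W: "W \<in> carrier_mat n n" "mat_adjoint W = - W"
  shows "\<exists>\<gamma>. stiefel_curve r n X \<gamma> (W * X)"
proof -
  note [simp] = stiefel_dims[OF X]
  have [simp]: "dim_row W = n" "dim_col W = n" using W by auto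
  define K where "K t = complex_of_real (t / 2) \<cdot>\<^sub>m W" for t
  have K: "K t \<in> carrier_mat n n" "mat_adjoint (K t) = - K t" for t
  proof -
    show "K t \<in> carrier_mat n n" by (rule carrier_matI) (simp_all add: K_def)
    show "mat_adjoint (K t) = - K t"
      unfolding K_def adjoint_smult W(2) by (rule eq_matI) simp_all
  qed
  have "\<exists>Y\<in>carrier_mat n r. Y - X = K t * (Y + X)" for t
    by (rule cayley_transform_exists[OF K stiefelD(1)[OF X]])
  then obtain \<gamma> where \<gamma>: "\<And>t. \<gamma> t \<in> carrier_mat n r" "\<And>t. \<gamma> t - X = K t * (\<gamma> t + X)"
    by metis
  have [simp]: "dim_row (\<gamma> t) = n" "dim_col (\<gamma> t) = r" for t
    by (simp_all add: carrier_matD[OF \<gamma>(1)])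
  have st: "\<gamma> t \<in> stiefel r n" for t
    using cayley_transform_isometric[OF K stiefelD(1)[OF X] \<gamma>(1) \<gamma>(2)] \<gamma>(1)[of t] stiefelD(2)[OF X]
    by (simp add: stiefel_def)
  define g where "g i j t = (\<Sum>k<n. W $$ (i, k) * (\<gamma> t $$ (k, j) + X $$ (k, j))) / 2" for i j t
  have step: "\<gamma> t $$ (i, j) - X $$ (i, j) = t *\<^sub>R g i j t" if "i < n" "j < r" for i j t
  proof -
    have "\<gamma> t $$ (i, j) - X $$ (i, j) = (K t * (\<gamma> t + X)) $$ (i, j)"
      using that by (simp flip: \<gamma>(2))
    also have "\<dots> = t *\<^sub>R g i j t"
      using that unfolding K_def g_def
      by (simp add: smult_mult_dim index_mult_sum scaleR_conv_of_real del: index_mult_mat(1))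
    finally show ?thesis .
  qed
  have at0: "\<gamma> 0 $$ (i, j) = X $$ (i, j)" if "i < n" "j < r" for i j
    using step[OF that, of 0] by simp
  have \<gamma>0: "\<gamma> 0 = X"
    by (rule eq_matI) (simp_all add: at0)
  have bound: "cmod (g i j t) \<le> (\<Sum>k<n. cmod (W $$ (i, k)))" if "i < n" "j < r" for i j t
  proof -
    have "cmod (\<Sum>k<n. W $$ (i, k) * (\<gamma> t $$ (k, j) + X $$ (k, j))) \<le> (\<Sum>k<n. cmod (W $$ (i, k)) * 2)"
    proof (rule sum_norm_le)
      fix k assume "k \<in> {..<n}"
      then have "cmod (\<gamma> t $$ (k, j)) \<le> 1" "cmod (X $$ (k, j)) \<le> 1"
        using that st X by (auto intro: stiefel_entry_le_1)
      then have "cmod (\<gamma> t $$ (k, j) + X $$ (k, j)) \<le> 2"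
        using norm_triangle_ineq[of "\<gamma> t $$ (k, j)" "X $$ (k, j)"] by linarith
      then show "cmod (W $$ (i, k) * (\<gamma> t $$ (k, j) + X $$ (k, j))) \<le> cmod (W $$ (i, k)) * 2"
        by (simp add: norm_mult mult_left_mono)
    qed
    then show ?thesis
      by (simp add: g_def norm_divide sum_distrib_right[symmetric])
  qed
  have cont: "isCont (\<lambda>t. \<gamma> t $$ (i, j)) 0" if "i < n" "j < r" for i j
  proof -
    have "((\<lambda>t. \<gamma> t $$ (i, j) - X $$ (i, j)) \<longlongrightarrow> 0) (at 0)"
    proof (rule tendsto_0_le)
      show "((\<lambda>t. t :: real) \<longlongrightarrow> 0) (at 0)" by (rule tendsto_ident_at)
      show "\<forall>\<^sub>F t in at 0. cmod (\<gamma> t $$ (i, j) - X $$ (i, j)) \<le> norm t * (\<Sum>k<n. cmod (W $$ (i, k)))"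
        using bound[OF that] by (intro always_eventually) (simp add: step[OF that] mult_left_mono)
    qed
    then show ?thesis
      unfolding isCont_def using at0[OF that] by (simp add: LIM_zero_iff)
  qed
  have "has_mat_derivative n r \<gamma> (W * X) 0"
    unfolding has_mat_derivative_def
  proof (intro conjI allI impI)
    show "W * X \<in> carrier_mat n r" by (rule carrier_matI) simp_all
    fix i j assume ij: "i < n" "j < r"
    have "((\<lambda>t. \<gamma> t $$ (i, j)) has_vector_derivative g i j 0) (at 0)"
    proof (rule has_vector_derivative_caratheodory)
      show "\<gamma> t $$ (i, j) - \<gamma> 0 $$ (i, j) = (t - 0) *\<^sub>R g i j t" for t
        using step[OF ij] at0[OF ij] by simp
      show "isCont (g i j) 0"
        unfolding g_def using cont ij(2) by (intro continuous_intros) auto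
    qed
    also have "g i j 0 = (W * X) $$ (i, j)"
      using ij at0 by (simp add: g_def index_mult_sum sum_divide_distrib del: index_mult_mat(1))
    finally show "((\<lambda>t. \<gamma> t $$ (i, j)) has_vector_derivative (W * X) $$ (i, j)) (at 0)" .
  qed
  with st \<gamma>0 show ?thesis
    unfolding stiefel_curve_def by blast
qed

text \<open>Differentiate \<open>\<gamma>\<^sup>H \<gamma> = 1\<close>.\<close>

lemma stiefel_curve_tangent:
  assumes "stiefel_curve r n X \<gamma> Z"
  shows "mat_adjoint (mat_adjoint X * Z) = - (mat_adjoint X * Z)"
proof -
  have \<gamma>: "\<And>t. \<gamma> t \<in> stiefel r n" "\<gamma> 0 = X" "has_mat_derivative n r \<gamma> Z 0"
    using assms unfolding stiefel_curve_def by auto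
  then have X: "X \<in> stiefel r n" by metis
  note [simp] = stiefel_dims[OF X] has_mat_derivative_dims[OF \<gamma>(3)]
  have c: "\<gamma> t \<in> carrier_mat n r" "mat_adjoint (\<gamma> t) \<in> carrier_mat r n" for t
    using stiefelD(1)[OF \<gamma>(1)] by auto
  have "has_mat_derivative r r (\<lambda>t. mat_adjoint (\<gamma> t) * \<gamma> t) (mat_adjoint X * Z + mat_adjoint Z * X) 0"
    using has_mat_derivative_mult[OF has_mat_derivative_adjoint[OF \<gamma>(3) c(1)] \<gamma>(3) c(2) c(1)]
    by (simp add: \<gamma>(2))
  moreover have "(\<lambda>t. mat_adjoint (\<gamma> t) * \<gamma> t) = (\<lambda>_. 1\<^sub>m r)"
    using stiefelD(2)[OF \<gamma>(1)] by auto
  ultimately have "has_mat_derivative r r (\<lambda>_. 1\<^sub>m r) (mat_adjoint X * Z + mat_adjoint Z * X) 0"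
    by simp
  from has_mat_derivative_unique[OF this has_mat_derivative_const]
  have *: "mat_adjoint X * Z + mat_adjoint Z * X = 0\<^sub>m r r" by simp
  show ?thesis
  proof (rule eq_matI)
    fix i j assume "i < dim_row (- (mat_adjoint X * Z))" "j < dim_col (- (mat_adjoint X * Z))"
    then show "mat_adjoint (mat_adjoint X * Z) $$ (i, j) = (- (mat_adjoint X * Z)) $$ (i, j)"
      using arg_cong[OF *, of "\<lambda>M. M $$ (i, j)"]
      by (simp add: adjoint_mult add_eq_0_iff del: index_mult_mat(1))
  qed simp_all
qed

text \<open>
  Conversely a matrix \<open>Z\<close> with \<open>X\<^sup>H Z\<close> skew-Hermitian is \<open>W X\<close> for the skew-Hermitian part \<open>W\<close> of
  \<open>2 (Z - X X\<^sup>H Z / 2) X\<^sup>H\<close>.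
\<close>

lemma skew_factor_exists:
  assumes X: "X \<in> stiefel r n" and Z: "Z \<in> carrier_mat n r"
    and skew: "mat_adjoint (mat_adjoint X * Z) = - (mat_adjoint X * Z)"
  shows "\<exists>W\<in>carrier_mat n n. mat_adjoint W = - W \<and> W * X = Z"
proof -
  note [simp] = stiefel_dims[OF X] stiefelD(2)[OF X]
  have [simp]: "dim_row Z = n" "dim_col Z = r" using Z by auto
  have ZX: "mat_adjoint Z * X = - (mat_adjoint X * Z)"
    using skew by (simp add: adjoint_mult)
  define M where "M = (Z - (1/2) \<cdot>\<^sub>m (X * (mat_adjoint X * Z))) * mat_adjoint X"
  have [simp]: "dim_row M = n" "dim_col M = n" by (simp_all add: M_def)
  define W where "W = M - mat_adjoint M"
  have MX: "M * X = Z - (1/2) \<cdot>\<^sub>m (X * (mat_adjoint X * Z))"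
    by (simp add: M_def mult_assoc_dim)
  have "mat_adjoint M * X = X * (mat_adjoint Z * X
      - (1/2) \<cdot>\<^sub>m (mat_adjoint Z * X * (mat_adjoint X * X)))"
    by (simp add: M_def adjoint_simps mat_ring_simps del: stiefelD(2)[OF X])
  also have "\<dots> = - ((1/2) \<cdot>\<^sub>m (X * (mat_adjoint X * Z)))"
  proof -
    have "mat_adjoint Z * X - (1/2) \<cdot>\<^sub>m (mat_adjoint Z * X) = (1/2) \<cdot>\<^sub>m (mat_adjoint Z * X)"
      by (rule eq_matI) (simp_all del: index_mult_mat(1))
    then show ?thesis
      by (simp add: ZX mult_smult_dim) (rule eq_matI, simp_all del: index_mult_mat(1))
  qed
  finally have MHX: "mat_adjoint M * X = - ((1/2) \<cdot>\<^sub>m (X * (mat_adjoint X * Z)))" .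
  have "W * X = M * X - mat_adjoint M * X"
    by (simp add: W_def minus_mult_dim)
  also have "\<dots> = Z"
    unfolding MX MHX by (rule eq_matI) (simp_all del: index_mult_mat(1))
  finally have "W * X = Z" .
  moreover have "mat_adjoint W = - W"
    unfolding W_def by (simp add: adjoint_minus) (rule eq_matI, simp_all)
  moreover have "W \<in> carrier_mat n n"
    unfolding W_def by (rule carrier_matI) simp_all
  ultimately show ?thesis by blast
qed

lemma tangent_space_eq:
  assumes X: "X \<in> stiefel r n"
  shows "tangent_space r n X =
    {Z \<in> carrier_mat n r. mat_adjoint (mat_adjoint X * Z) = - (mat_adjoint X * Z)}"
proof (intro equalityI subsetI)
  fix Z assume "Z \<in> tangent_space r n X"
  then obtain \<gamma> where \<gamma>: "stiefel_curve r n X \<gamma> Z"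
    unfolding tangent_space_def by blast
  then have "Z \<in> carrier_mat n r"
    unfolding stiefel_curve_def has_mat_derivative_def by blast
  with stiefel_curve_tangent[OF \<gamma>]
  show "Z \<in> {Z \<in> carrier_mat n r. mat_adjoint (mat_adjoint X * Z) = - (mat_adjoint X * Z)}"
    by blast
next
  fix Z assume "Z \<in> {Z \<in> carrier_mat n r. mat_adjoint (mat_adjoint X * Z) = - (mat_adjoint X * Z)}"
  then obtain W where W: "W \<in> carrier_mat n n" "mat_adjoint W = - W" "W * X = Z"
    using skew_factor_exists[OF X] by blast
  from stiefel_curve_skew[OF X W(1,2)] show "Z \<in> tangent_space r n X"
    unfolding tangent_space_def W(3) by blast
qed

section \<open>Gradient and Hessian of a Hermitian quadratic form\<close>

text \<open>
  The function is \<open>X \<mapsto> tr (X\<^sup>H S X)\<close> with \<open>S\<close> Hermitian; its ambient gradient \<open>2 S X\<close> has the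
  tangential part \<open>2 (1 - X X\<^sup>H) S X\<close>.
\<close>

definition quadratic_gradient :: "complex mat \<Rightarrow> complex mat \<Rightarrow> complex mat" where
  "quadratic_gradient S X = 2 \<cdot>\<^sub>m (S * X - X * (mat_adjoint X * (S * X)))"

lemma quadratic_gradient_correct:
  assumes S: "S \<in> carrier_mat n n" "mat_adjoint S = S" and X: "X \<in> stiefel r n"
    and h: "\<And>X. X \<in> stiefel r n \<Longrightarrow> h X = re_inner X (S * X)"
  shows "has_riem_gradient r n h X (quadratic_gradient S X)"
  unfolding has_riem_gradient_def
proof (intro conjI allI impI)
  note [simp] = stiefel_dims[OF X]
  have [simp]: "dim_row S = n" "dim_col S = n" using S by auto
  define M where "M = mat_adjoint X * (S * X)"
  have [simp]: "dim_row M = r" "dim_col M = r" by (simp_all add: M_def)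
  have M: "mat_adjoint M = M"
    by (simp add: M_def adjoint_mult mult_assoc_dim S(2))
  have "mat_adjoint X * (X * M) = M"
    by (simp add: mult_assoc_dim[symmetric] stiefelD(2)[OF X])
  then have "mat_adjoint X * quadratic_gradient S X = 2 \<cdot>\<^sub>m (M - M)"
    unfolding quadratic_gradient_def by (simp add: mat_ring_simps flip: M_def)
  also have "\<dots> = 0\<^sub>m r r"
    by (rule eq_matI) simp_all
  finally have "mat_adjoint X * quadratic_gradient S X = 0\<^sub>m r r" .
  moreover have "mat_adjoint (0\<^sub>m r r) = - (0\<^sub>m r r :: complex mat)"
    by (rule eq_matI) simp_all
  moreover have "quadratic_gradient S X \<in> carrier_mat n r"
    unfolding quadratic_gradient_def by (rule carrier_matI) simp_all
  ultimately show "quadratic_gradient S X \<in> tangent_space r n X"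
    unfolding tangent_space_eq[OF X] by simp
  fix \<gamma> Z assume \<gamma>Z: "stiefel_curve r n X \<gamma> Z"
  then have \<gamma>: "\<And>t. \<gamma> t \<in> stiefel r n" "\<gamma> 0 = X" "has_mat_derivative n r \<gamma> Z 0"
    unfolding stiefel_curve_def by auto
  note [simp] = has_mat_derivative_dims[OF \<gamma>(3)]
  have c: "\<gamma> t \<in> carrier_mat n r" "S * \<gamma> t \<in> carrier_mat n r" for t
    using stiefelD(1)[OF \<gamma>(1)] S(1) by (auto intro: mult_carrier_mat)
  have "has_mat_derivative n r (\<lambda>t. S * \<gamma> t) (S * Z + 0\<^sub>m n n * X) 0"
    using has_mat_derivative_mult[OF has_mat_derivative_const[OF S(1)] \<gamma>(3) S(1) c(1)] \<gamma>(2) by simp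
  moreover have "S * Z + 0\<^sub>m n n * X = S * Z"
    by (rule eq_matI) (simp_all del: index_mult_mat(1))
  ultimately have "has_mat_derivative n r (\<lambda>t. S * \<gamma> t) (S * Z) 0"
    by simp
  from re_inner_has_derivative[OF \<gamma>(3) this c]
  have "((\<lambda>t. h (\<gamma> t)) has_real_derivative re_inner X (S * Z) + re_inner Z (S * X)) (at 0)"
    by (simp add: \<gamma>(2) h[OF \<gamma>(1)])
  moreover have "re_inner X (S * Z) = re_inner (S * X) Z"
    by (simp add: re_inner_mult_left S(2))
  moreover have "re_inner Z (S * X) = re_inner (S * X) Z"
    by (simp add: re_inner_commute)
  \<comment> \<open>The normal part \<open>2 X M\<close> of the ambient gradient pairs to \<open>2 Re tr (M X\<^sup>H Z) = 0\<close>.\<close>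
  moreover have "re_inner (X * M) Z = 0"
    using stiefel_curve_tangent[OF \<gamma>Z]
    by (simp add: re_inner_mult_right re_inner_hermitian_skew M)
  moreover have "re_inner (quadratic_gradient S X) Z
      = 2 * (re_inner (S * X) Z - re_inner (X * M) Z)"
    unfolding quadratic_gradient_def M_def
    using re_inner_smult_left[of "S * X - X * (mat_adjoint X * (S * X))" Z 2]
    by (simp add: re_inner_minus_left)
  ultimately show "((\<lambda>t. h (\<gamma> t)) has_real_derivative re_inner (quadratic_gradient S X) Z) (at 0)"
    by simp
qed

lemma quadratic_gradient_derivative:
  assumes S: "S \<in> carrier_mat n n" and \<gamma>Z: "stiefel_curve r n X \<gamma> Z"
  shows "has_mat_derivative n r (\<lambda>t. quadratic_gradient S (\<gamma> t))
    (2 \<cdot>\<^sub>m (S * Z - (X * (mat_adjoint X * (S * Z) + mat_adjoint Z * (S * X))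
      + Z * (mat_adjoint X * (S * X))))) 0"
proof -
  have \<gamma>: "\<And>t. \<gamma> t \<in> stiefel r n" "\<gamma> 0 = X" "has_mat_derivative n r \<gamma> Z 0"
    using \<gamma>Z unfolding stiefel_curve_def by auto
  then have X: "X \<in> stiefel r n" by metis
  note [simp] = stiefel_dims[OF X] has_mat_derivative_dims[OF \<gamma>(3)]
  have [simp]: "dim_row S = n" "dim_col S = n" using S by auto
  have [simp]: "dim_row (\<gamma> t) = n" "dim_col (\<gamma> t) = r" for t
    by (simp_all add: stiefel_dims[OF \<gamma>(1)])
  have c: "\<gamma> t \<in> carrier_mat n r" "S * \<gamma> t \<in> carrier_mat n r" "mat_adjoint (\<gamma> t) \<in> carrier_mat r n"
    "mat_adjoint (\<gamma> t) * (S * \<gamma> t) \<in> carrier_mat r r"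
    "\<gamma> t * (mat_adjoint (\<gamma> t) * (S * \<gamma> t)) \<in> carrier_mat n r"
    "S * \<gamma> t - \<gamma> t * (mat_adjoint (\<gamma> t) * (S * \<gamma> t)) \<in> carrier_mat n r" for t
    by (rule carrier_matI; simp)+
  have "has_mat_derivative n r (\<lambda>t. S * \<gamma> t) (S * Z + 0\<^sub>m n n * X) 0"
    using has_mat_derivative_mult[OF has_mat_derivative_const[OF S] \<gamma>(3) S c(1)] \<gamma>(2) by simp
  moreover have "S * Z + 0\<^sub>m n n * X = S * Z"
    by (rule eq_matI) (simp_all del: index_mult_mat(1))
  ultimately have 1: "has_mat_derivative n r (\<lambda>t. S * \<gamma> t) (S * Z) 0"
    by simp
  note 2 = has_mat_derivative_mult[OF has_mat_derivative_adjoint[OF \<gamma>(3) c(1)] 1 c(3) c(2)]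
  note 3 = has_mat_derivative_mult[OF \<gamma>(3) 2 c(1) c(4)]
  note 4 = has_mat_derivative_smult[OF has_mat_derivative_minus[OF 1 3 c(2) c(5)] c(6), of 2]
  then show ?thesis
    unfolding quadratic_gradient_def \<gamma>(2) .
qed

text \<open>
  The Hessian of \<open>tr (X\<^sup>H S X)\<close> at \<open>U\<close> for \<open>S = U B U\<^sup>H\<close>: as \<open>(1 - U U\<^sup>H) S = 0\<close>, only
  \<open>- 2 (1 - U U\<^sup>H) Z B\<close> survives in the derivative of the gradient.
\<close>

definition eigen_hessian :: "complex mat \<Rightarrow> complex mat \<Rightarrow> complex mat \<Rightarrow> complex mat" where
  "eigen_hessian U B Z = - 2 \<cdot>\<^sub>m ((Z - U * (mat_adjoint U * Z)) * B)"

lemma eigen_hessian_dims [simp]: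
  "dim_row (eigen_hessian U B Z) = dim_row U" "dim_col (eigen_hessian U B Z) = dim_col B"
  unfolding eigen_hessian_def by simp_all

lemma adjoint_mult_eigen_hessian:
  assumes U: "U \<in> stiefel r n" and B: "B \<in> carrier_mat r r" and Z: "Z \<in> carrier_mat n r"
  shows "mat_adjoint U * eigen_hessian U B Z = 0\<^sub>m r r"
proof -
  note [simp] = stiefel_dims[OF U]
  have [simp]: "dim_row B = r" "dim_col B = r" "dim_row Z = n" "dim_col Z = r" using B Z by auto
  have "mat_adjoint U * (Z - U * (mat_adjoint U * Z))
      = mat_adjoint U * Z - mat_adjoint U * U * (mat_adjoint U * Z)"
    by (simp add: mult_minus_dim mult_assoc_dim)
  also have "\<dots> = 0\<^sub>m r r"
    unfolding stiefelD(2)[OF U] by (rule eq_matI) (simp_all del: index_mult_mat(1))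
  finally have "mat_adjoint U * (Z - U * (mat_adjoint U * Z)) * B = 0\<^sub>m r r"
    by simp
  then have "mat_adjoint U * eigen_hessian U B Z = - 2 \<cdot>\<^sub>m 0\<^sub>m r r"
    unfolding eigen_hessian_def by (simp add: mult_assoc_dim mult_smult_dim)
  then show ?thesis by simp
qed

lemma tangent_if_adjoint_mult_0:
  assumes U: "U \<in> stiefel r n" and "Y \<in> carrier_mat n r" "mat_adjoint U * Y = 0\<^sub>m r r"
  shows "Y \<in> tangent_space r n U"
proof -
  have "mat_adjoint (0\<^sub>m r r) = - (0\<^sub>m r r :: complex mat)"
    by (rule eq_matI) simp_all
  with assms show ?thesis by (simp add: tangent_space_eq)
qed

lemma quadratic_gradient_derivative_eigen:
  assumes U: "U \<in> stiefel r n" and B: "B \<in> carrier_mat r r" and \<gamma>Z: "stiefel_curve r n U \<gamma> Z"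
  shows "has_mat_derivative n r (\<lambda>t. quadratic_gradient (U * (B * mat_adjoint U)) (\<gamma> t))
    (eigen_hessian U B Z) 0"
proof -
  note [simp] = stiefel_dims[OF U] stiefelD(2)[OF U]
  have "Z \<in> tangent_space r n U"
    using \<gamma>Z unfolding tangent_space_def by blast
  then have "Z \<in> carrier_mat n r" and skew: "mat_adjoint (mat_adjoint U * Z) = - (mat_adjoint U * Z)"
    by (simp_all add: tangent_space_eq[OF U])
  then have [simp]: "dim_row Z = n" "dim_col Z = r" by auto
  have [simp]: "dim_row B = r" "dim_col B = r" using B by auto
  define S where "S = U * (B * mat_adjoint U)"
  have S: "S \<in> carrier_mat n n" unfolding S_def by (rule carrier_matI) simp_all
  have SU: "S * U = U * B"
    by (simp add: S_def mult_assoc_dim)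
  have UU: "mat_adjoint U * (U * C) = C" if "dim_row C = r" for C
    using that by (simp flip: mult_assoc_dim)
  have USZ: "mat_adjoint U * (S * Z) = B * (mat_adjoint U * Z)"
    by (simp add: S_def mult_assoc_dim UU)
  have SZ: "S * Z = U * (B * (mat_adjoint U * Z))"
    by (simp add: S_def mult_assoc_dim)
  have ZU: "mat_adjoint Z * U = - (mat_adjoint U * Z)"
    using skew by (simp add: adjoint_mult)
  have "mat_adjoint Z * (S * U) = mat_adjoint Z * U * B"
    unfolding SU by (simp add: mult_assoc_dim)
  then have ZSU: "mat_adjoint Z * (S * U) = - (mat_adjoint U * (Z * B))"
    unfolding ZU by (simp add: mult_assoc_dim)
  have "2 \<cdot>\<^sub>m (S * Z - (U * (mat_adjoint U * (S * Z) + mat_adjoint Z * (S * U))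
      + Z * (mat_adjoint U * (S * U)))) = eigen_hessian U B Z"
    unfolding USZ ZSU unfolding SZ SU UU eigen_hessian_def
    by (simp add: mat_ring_simps UU) (rule eq_matI, simp_all del: index_mult_mat(1))
  with quadratic_gradient_derivative[OF S \<gamma>Z] show ?thesis
    unfolding S_def by simp
qed

section \<open>Real spaces of complex matrices\<close>

definition real_mat_subspace :: "nat \<Rightarrow> nat \<Rightarrow> complex mat set \<Rightarrow> bool" where
  "real_mat_subspace n r W \<longleftrightarrow> W \<subseteq> carrier_mat n r \<and> 0\<^sub>m n r \<in> W \<and>
    (\<forall>A\<in>W. \<forall>B\<in>W. A + B \<in> W) \<and> (\<forall>a. \<forall>A\<in>W. complex_of_real a \<cdot>\<^sub>m A \<in> W)"

lemma real_mat_subspace_vectorspace: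
  assumes W: "real_mat_subspace n r W"
  shows "vectorspace class_ring (real_mat_module n r W)"
proof -
  let ?M = "real_mat_module n r W"
  have sub: "A \<in> carrier_mat n r" if "A \<in> W" for A
    using W that unfolding real_mat_subspace_def by blast
  have closed: "0\<^sub>m n r \<in> W" "A \<in> W \<Longrightarrow> B \<in> W \<Longrightarrow> A + B \<in> W"
      "A \<in> W \<Longrightarrow> complex_of_real a \<cdot>\<^sub>m A \<in> W" for A B a
    using W unfolding real_mat_subspace_def by blast+
  have inv: "\<exists>B\<in>W. B + A = 0\<^sub>m n r" if "A \<in> W" for A
  proof
    have "dim_row A = n" "dim_col A = r" using sub[OF that] by auto
    then show "complex_of_real (- 1) \<cdot>\<^sub>m A + A = 0\<^sub>m n r"
      by (intro eq_matI) simp_all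
  qed (rule closed(3)[OF that])
  note group_laws = assoc_add_mat[OF sub sub sub] comm_add_mat[OF sub sub] left_add_zero_mat[OF sub]
  have "abelian_group ?M"
    by (rule abelian_groupI) (simp_all add: real_mat_module_def closed inv group_laws(1,3),
      rule group_laws(2))
  moreover have "complex_of_real (a + b) \<cdot>\<^sub>m A = complex_of_real a \<cdot>\<^sub>m A + complex_of_real b \<cdot>\<^sub>m A"
    "complex_of_real (a * b) \<cdot>\<^sub>m A = complex_of_real a \<cdot>\<^sub>m (complex_of_real b \<cdot>\<^sub>m A)"
    "complex_of_real 1 \<cdot>\<^sub>m A = A" for a b A
    by (rule eq_matI; simp add: distrib_right)+
  moreover have "complex_of_real a \<cdot>\<^sub>m (A + B) = complex_of_real a \<cdot>\<^sub>m A + complex_of_real a \<cdot>\<^sub>m B"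
    if "A \<in> W" "B \<in> W" for a A B
    using sub[OF that(1)] sub[OF that(2)] by (rule add_smult_distrib_left_mat)
  ultimately have "Module.module class_ring ?M"
    using class_cring.cring_axioms
    by (intro moduleI) (simp_all add: real_mat_module_def closed)
  then show ?thesis
    unfolding vectorspace_def using class_field by blast
qed

lemma adjoint_kernel_subspace:
  assumes U: "U \<in> carrier_mat n r"
  shows "real_mat_subspace n r {Y \<in> carrier_mat n r. mat_adjoint U * Y = 0\<^sub>m r r}"
proof -
  have [simp]: "dim_row U = n" "dim_col U = r" using U by auto
  let ?N = "{Y \<in> carrier_mat n r. mat_adjoint U * Y = 0\<^sub>m r r}"
  have "A + B \<in> ?N" "complex_of_real a \<cdot>\<^sub>m A \<in> ?N" if "A \<in> ?N" "B \<in> ?N" for A B a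
  proof -
    have c: "A \<in> carrier_mat n r" "B \<in> carrier_mat n r"
      using that by blast+
    note [simp] = carrier_matD[OF c(1)] carrier_matD[OF c(2)]
    show "A + B \<in> ?N" "complex_of_real a \<cdot>\<^sub>m A \<in> ?N"
      using that by (simp_all add: mult_add_dim mult_smult_dim)
  qed
  moreover have "0\<^sub>m n r \<in> ?N" by simp
  ultimately show ?thesis
    unfolding real_mat_subspace_def by blast
qed

lemma tangent_space_subspace:
  assumes U: "U \<in> stiefel r n"
  shows "real_mat_subspace n r (tangent_space r n U)"
proof -
  note [simp] = stiefel_dims[OF U]
  have "mat_adjoint (mat_adjoint U * (A + B)) = - (mat_adjoint U * (A + B))"
    if "A \<in> carrier_mat n r" "mat_adjoint (mat_adjoint U * A) = - (mat_adjoint U * A)"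
      "B \<in> carrier_mat n r" "mat_adjoint (mat_adjoint U * B) = - (mat_adjoint U * B)" for A B
  proof -
    have [simp]: "dim_row A = n" "dim_col A = r" "dim_row B = n" "dim_col B = r"
      using that by auto
    have "mat_adjoint (mat_adjoint U * (A + B)) = - (mat_adjoint U * A) + - (mat_adjoint U * B)"
      by (simp add: mult_add_dim adjoint_add that(2,4))
    then show ?thesis
      by (simp add: mult_add_dim) (rule eq_matI, simp_all del: index_mult_mat(1))
  qed
  moreover have "mat_adjoint (mat_adjoint U * (complex_of_real a \<cdot>\<^sub>m A))
      = - (mat_adjoint U * (complex_of_real a \<cdot>\<^sub>m A))"
    if "A \<in> carrier_mat n r" "mat_adjoint (mat_adjoint U * A) = - (mat_adjoint U * A)" for A a
  proof -
    have [simp]: "dim_row A = n" "dim_col A = r"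
      using that by auto
    have "mat_adjoint (mat_adjoint U * (complex_of_real a \<cdot>\<^sub>m A))
        = complex_of_real a \<cdot>\<^sub>m - (mat_adjoint U * A)"
      by (simp add: mult_smult_dim adjoint_smult that(2))
    then show ?thesis
      by (simp add: mult_smult_dim) (rule eq_matI, simp_all del: index_mult_mat(1))
  qed
  moreover have "0\<^sub>m n r \<in> tangent_space r n U"
    by (rule tangent_if_adjoint_mult_0[OF U]) simp_all
  ultimately show ?thesis
    unfolding real_mat_subspace_def tangent_space_eq[OF U] by simp
qed

lemma linear_map_real_mat_moduleI:
  assumes V: "real_mat_subspace n r V" and H: "\<And>Z. Z \<in> V \<Longrightarrow> H Z \<in> V"
    and "\<And>Y Z. Y \<in> V \<Longrightarrow> Z \<in> V \<Longrightarrow> H (Y + Z) = H Y + H Z"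
    and "\<And>a Z. Z \<in> V \<Longrightarrow> H (complex_of_real a \<cdot>\<^sub>m Z) = complex_of_real a \<cdot>\<^sub>m H Z"
  shows "linear_map class_ring (real_mat_module n r V) (real_mat_module n r V) H"
proof -
  let ?V = "real_mat_module n r V"
  have vs: "vectorspace class_ring ?V"
    by (rule real_mat_subspace_vectorspace[OF V])
  moreover have "H \<in> LinearCombinations.module_hom class_ring ?V ?V"
    using assms(2-4) unfolding LinearCombinations.module_hom_def by (simp add: real_mat_module_def)
  ultimately show ?thesis
    by (intro linear_map.intro mod_hom.intro mod_hom_axioms.intro) (simp_all add: vectorspace_def)
qed

text \<open>
  Multiplication by the unitary \<open>F\<^sup>H\<close> turns \<open>N\<close> into the matrices whose first \<open>r\<close> rows vanish.
  Reading off the real and imaginary parts of the other \<open>n - r\<close> rows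
  identifies these with the real vectors of length \<open>2 r (n - r)\<close>; \<open>e\<close> numbers the coordinates.
\<close>

lemma dim_lower_rows:
  fixes F :: "complex mat"
  assumes F: "F \<in> carrier_mat n n" "mat_adjoint F * F = 1\<^sub>m n"
    and N: "N = {Y \<in> carrier_mat n r. \<forall>i<r. \<forall>j<r. (mat_adjoint F * Y) $$ (i, j) = 0}"
    and sub: "real_mat_subspace n r N" and rn: "r \<le> n"
  shows "vectorspace.dim class_ring (real_mat_module n r N) = 2 * r * (n - r)"
proof -
  have [simp]: "dim_row F = n" "dim_col F = n" using F by auto
  have FF: "F * mat_adjoint F = 1\<^sub>m n"
    by (rule mat_mult_left_right_inverse[OF _ F(1) F(2)]) (simp add: F(1))
  define I where "I = {r..<n} \<times> {..<r} \<times> (UNIV :: bool set)"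
  define k where "k = card I"
  have k: "k = 2 * r * (n - r)"
    by (simp add: k_def I_def card_cartesian_product)
  have "finite I" by (simp add: I_def)
  then obtain e where e: "bij_betw e I {0..<k}"
    unfolding k_def using ex_bij_betw_finite_nat by blast
  then have e_less: "e x < k" if "x \<in> I" for x
    using that bij_betwE by fastforce
  define m :: "real vec \<Rightarrow> complex mat" where
    "m v = mat n r (\<lambda>(i, j). if i < r then 0
      else Complex (v $ e (i, j, True)) (v $ e (i, j, False)))" for v
  have [simp]: "dim_row (m v) = n" "dim_col (m v) = r" for v by (simp_all add: m_def)
  define \<phi> where "\<phi> v = F * m v" for v
  have F\<phi>: "mat_adjoint F * \<phi> v = m v" for v
    by (simp add: \<phi>_def mult_assoc_dim[symmetric] F(2))
  have II: "(i, j, b) \<in> I" if "\<not> i < r" "i < n" "j < r" for i j b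
    using that by (simp add: I_def)
  interpret V: vec_space "TYPE(real)" k .
  interpret W: vectorspace class_ring "real_mat_module n r N"
    by (rule real_mat_subspace_vectorspace[OF sub])
  have \<phi>_add: "\<phi> (v + w) = \<phi> v + \<phi> w" if v: "v \<in> carrier_vec k" and w: "w \<in> carrier_vec k" for v w
  proof -
    note [simp] = carrier_vecD[OF v] carrier_vecD[OF w]
    have "m (v + w) = m v + m w"
      by (rule eq_matI) (simp_all add: m_def complex_eq_iff e_less II)
    then show ?thesis by (simp add: \<phi>_def mult_add_dim)
  qed
  have \<phi>_smult: "\<phi> (a \<cdot>\<^sub>v v) = complex_of_real a \<cdot>\<^sub>m \<phi> v" if v: "v \<in> carrier_vec k" for v a
  proof -
    note [simp] = carrier_vecD[OF v]
    have "m (a \<cdot>\<^sub>v v) = complex_of_real a \<cdot>\<^sub>m m v"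
      by (rule eq_matI) (simp_all add: m_def complex_eq_iff e_less II)
    then show ?thesis by (simp add: \<phi>_def mult_smult_dim)
  qed
  have \<phi>N: "\<phi> v \<in> N" for v
  proof -
    have "\<phi> v \<in> carrier_mat n r" by (rule carrier_matI) (simp_all add: \<phi>_def)
    moreover have "\<forall>i<r. \<forall>j<r. m v $$ (i, j) = 0" using rn by (simp add: m_def)
    ultimately show ?thesis unfolding N by (simp add: F\<phi>)
  qed
  interpret L: linear_map class_ring "module_vec TYPE(real) k" "real_mat_module n r N" \<phi>
  proof (intro linear_map.intro mod_hom.intro mod_hom_axioms.intro)
    show "vectorspace class_ring (module_vec TYPE(real) k)" by (rule vec_vs)
    show "Module.module class_ring (module_vec TYPE(real) k)" by (rule vec_module)
    show "vectorspace class_ring (real_mat_module n r N)" by (rule W.vectorspace_axioms)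
    show "Module.module class_ring (real_mat_module n r N)" by (rule W.module_axioms)
    show "\<phi> \<in> LinearCombinations.module_hom class_ring (module_vec TYPE(real) k) (real_mat_module n r N)"
      unfolding LinearCombinations.module_hom_def
      by (simp add: real_mat_module_def module_vec_simps \<phi>N \<phi>_add \<phi>_smult)
  qed
  have "inj_on \<phi> (carrier_vec k)"
  proof (rule inj_onI)
    fix v w assume v: "v \<in> carrier_vec k" and w: "w \<in> carrier_vec k" and eq: "\<phi> v = \<phi> w"
    then have m: "m v = m w" by (metis F\<phi>)
    have "v $ t = w $ t" if "t < k" for t
    proof -
      from that e obtain i j b where x: "(i, j, b) \<in> I" "t = e (i, j, b)"
        by (metis atLeast0LessThan bij_betw_imp_surj_on imageE lessThan_iff prod_cases3)
      then have "\<not> i < r" "i < n" "j < r" by (auto simp: I_def)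
      with arg_cong[OF m, of "\<lambda>M. M $$ (i, j)"] show ?thesis
        unfolding x(2) by (cases b) (simp_all add: m_def)
    qed
    with v w show "v = w" by (intro eq_vecI) auto
  qed
  moreover have "\<phi> ` carrier_vec k = N"
  proof (intro equalityI subsetI)
    fix Y assume Y: "Y \<in> N"
    then have [simp]: "dim_row Y = n" "dim_col Y = r" unfolding N by auto
    define c where "c = (\<lambda>(i, j, b). let z = (mat_adjoint F * Y) $$ (i, j) in if b then Re z else Im z)"
    define v where "v = vec k (\<lambda>t. c (inv_into I e t))"
    have v: "v $ e x = c x" if "x \<in> I" for x
      using that e by (simp add: v_def e_less bij_betw_inv_into_left)
    have "m v = mat_adjoint F * Y"
    proof (rule eq_matI)
      fix i j assume "i < dim_row (mat_adjoint F * Y)" "j < dim_col (mat_adjoint F * Y)"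
      then show "m v $$ (i, j) = (mat_adjoint F * Y) $$ (i, j)"
        using Y II[of i j] unfolding N
        by (simp add: m_def v c_def complex_eq_iff del: index_mult_mat(1))
    qed simp_all
    then have "\<phi> v = F * mat_adjoint F * Y"
      by (simp add: \<phi>_def mult_assoc_dim)
    then have "\<phi> v = Y" by (simp add: FF)
    moreover have "v \<in> carrier_vec k" by (simp add: v_def)
    ultimately show "Y \<in> \<phi> ` carrier_vec k" by blast
  qed (use \<phi>N in auto)
  ultimately show ?thesis
    using L.dim_eq[OF V.fin_dim] V.dim_is_n k
    by (simp add: real_mat_module_def module_vec_simps)
qed

section \<open>Semi-nondegeneracy of diagonalised quadratic forms\<close>

lemma rect_id_dims [simp]: "dim_row (rect_id n r) = n" "dim_col (rect_id n r) = r"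
  unfolding rect_id_def by simp_all

lemma index_adjoint_rect_id_mult:
  assumes "dim_row M = n" "r \<le> n" "i < r" "j < dim_col M"
  shows "(mat_adjoint (rect_id n r) * M) $$ (i, j) = M $$ (i, j)"
proof -
  have "(mat_adjoint (rect_id n r) * M) $$ (i, j) = (\<Sum>k<n. cnj (rect_id n r $$ (k, i)) * M $$ (k, j))"
    using assms by (simp add: index_mult_sum del: index_mult_mat(1))
  also have "\<dots> = (\<Sum>k<n. if k = i then M $$ (k, j) else 0)"
    using assms by (intro sum.cong) (auto simp: rect_id_def)
  also have "\<dots> = M $$ (i, j)"
    using assms by simp
  finally show ?thesis .
qed

lemma unitary_leading_columns_stiefel:
  assumes F: "F \<in> carrier_mat n n" "mat_adjoint F * F = 1\<^sub>m n" and rn: "r \<le> n"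
  shows "F * rect_id n r \<in> stiefel r n"
proof -
  have [simp]: "dim_row F = n" "dim_col F = n" using F by auto
  have "mat_adjoint (F * rect_id n r) * (F * rect_id n r)
      = mat_adjoint (rect_id n r) * (mat_adjoint F * F * rect_id n r)"
    by (simp add: adjoint_mult mult_assoc_dim)
  also have "\<dots> = 1\<^sub>m r"
  proof (rule eq_matI)
    fix i j assume "i < dim_row (1\<^sub>m r :: complex mat)" "j < dim_col (1\<^sub>m r :: complex mat)"
    then show "(mat_adjoint (rect_id n r) * (mat_adjoint F * F * rect_id n r)) $$ (i, j) = 1\<^sub>m r $$ (i, j)"
      using rn by (simp add: F(2) index_adjoint_rect_id_mult del: index_mult_mat(1)) (simp add: rect_id_def)
  qed simp_all
  finally show ?thesis
    by (intro stiefelI) simp_all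
qed

lemma stiefel_mult_unitary:
  assumes X: "X \<in> stiefel r n" and R: "R \<in> carrier_mat r r" "mat_adjoint R * R = 1\<^sub>m r"
  shows "X * R \<in> stiefel r n"
proof -
  note [simp] = stiefel_dims[OF X]
  have [simp]: "dim_row R = r" "dim_col R = r" using R by auto
  have "mat_adjoint (X * R) * (X * R) = mat_adjoint R * (mat_adjoint X * X * R)"
    by (simp add: adjoint_mult mult_assoc_dim)
  then show ?thesis
    by (intro stiefelI) (simp_all add: stiefelD(2)[OF X] R(2))
qed

text \<open>\<open>tr (R\<^sup>H X\<^sup>H S X R) = tr (X\<^sup>H S X R R\<^sup>H)\<close>; the formal proof moves \<open>R\<close> by passing to adjoints.\<close>

lemma quadratic_form_unitarily_invariant:
  assumes S: "S \<in> carrier_mat n n"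
    and h: "\<And>X. X \<in> stiefel r n \<Longrightarrow> h X = re_inner X (S * X)"
  shows "unitarily_invariant r n h"
  unfolding unitarily_invariant_def
proof (intro ballI impI)
  fix X R :: "complex mat"
  assume X: "X \<in> stiefel r n" and R: "R \<in> carrier_mat r r" "mat_adjoint R * R = 1\<^sub>m r"
  note [simp] = stiefel_dims[OF X]
  have [simp]: "dim_row R = r" "dim_col R = r" using R by auto
  have [simp]: "dim_row S = n" "dim_col S = n" using S by auto
  have RR: "R * mat_adjoint R = 1\<^sub>m r"
    by (rule mat_mult_left_right_inverse[OF _ R(1) R(2)]) (simp add: R(1))
  have "re_inner (X * R) (S * (X * R)) = re_inner (mat_adjoint (X * R)) (mat_adjoint (S * X * R))"
    by (subst re_inner_adjoint) (simp_all add: mult_assoc_dim)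
  also have "\<dots> = re_inner (mat_adjoint X) (R * mat_adjoint R * mat_adjoint (S * X))"
    by (simp add: adjoint_mult re_inner_mult_left mult_assoc_dim)
  also have "\<dots> = re_inner X (S * X)"
    by (simp add: RR re_inner_adjoint)
  finally show "h (X * R) = h X"
    by (simp add: h X stiefel_mult_unitary[OF X R])
qed

text \<open>
  The Hessian maps onto the horizontal space \<open>{Y. U\<^sup>H Y = 0}\<close>, the orthogonal complement in the
  tangent space of the directions of unitary invariance.  Onto needs an invertible \<open>B\<close>, except
  for \<open>n = r\<close>, when the horizontal space is trivial.
\<close>

lemma eigen_hessian_image:
  assumes U: "U \<in> stiefel r n" and B: "B \<in> carrier_mat r r"
    and nondeg: "n = r \<or> (\<exists>C\<in>carrier_mat r r. C * B = 1\<^sub>m r)"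
  shows "eigen_hessian U B ` tangent_space r n U = {Y \<in> carrier_mat n r. mat_adjoint U * Y = 0\<^sub>m r r}"
proof (intro equalityI subsetI)
  note [simp] = stiefel_dims[OF U]
  have [simp]: "dim_row B = r" "dim_col B = r" using B by auto
  fix Y
  {
    assume "Y \<in> eigen_hessian U B ` tangent_space r n U"
    then obtain Z where Z: "Z \<in> tangent_space r n U" and Y: "Y = eigen_hessian U B Z"
      by blast
    from Z have "Z \<in> carrier_mat n r" by (simp add: tangent_space_eq[OF U])
    from adjoint_mult_eigen_hessian[OF U B this]
    show "Y \<in> {Y \<in> carrier_mat n r. mat_adjoint U * Y = 0\<^sub>m r r}"
      unfolding Y by (intro CollectI conjI carrier_matI) simp_all
  }
  assume "Y \<in> {Y \<in> carrier_mat n r. mat_adjoint U * Y = 0\<^sub>m r r}"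
  then have Y: "Y \<in> carrier_mat n r" "mat_adjoint U * Y = 0\<^sub>m r r" by blast+
  note [simp] = carrier_matD[OF Y(1)]
  consider (square) "n = r" | (inverse) C where "C \<in> carrier_mat r r" "C * B = 1\<^sub>m r"
    using nondeg by blast
  then show "Y \<in> eigen_hessian U B ` tangent_space r n U"
  proof cases
    case square
    have "U * mat_adjoint U = 1\<^sub>m n"
      by (rule mat_mult_left_right_inverse) (use stiefelD[OF U] square in simp_all)
    moreover have "U * mat_adjoint U * Y = 0\<^sub>m n r"
      by (simp add: mult_assoc_dim Y(2))
    ultimately have "Y = 0\<^sub>m n r" by simp
    moreover have "eigen_hessian U B (0\<^sub>m n r) = 0\<^sub>m n r"
      by (simp add: eigen_hessian_def square minus_r_inv_mat[OF zero_carrier_mat])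
    moreover have "0\<^sub>m n r \<in> tangent_space r n U"
      using tangent_space_subspace[OF U] unfolding real_mat_subspace_def by blast
    ultimately show ?thesis by (metis imageI)
  next
    case inverse
    note [simp] = carrier_matD[OF inverse(1)]
    define Z where "Z = (- (1/2)) \<cdot>\<^sub>m (Y * C)"
    have Zd [simp]: "dim_row Z = n" "dim_col Z = r" by (simp_all add: Z_def)
    have UZ: "mat_adjoint U * Z = 0\<^sub>m r r"
      by (simp add: Z_def mult_smult_dim mult_assoc_dim[symmetric] Y(2))
    have "Z \<in> tangent_space r n U"
      by (rule tangent_if_adjoint_mult_0[OF U _ UZ]) (rule carrier_matI, simp_all)
    moreover have "eigen_hessian U B Z = Y"
    proof -
      have "Z - U * (mat_adjoint U * Z) = Z"
        unfolding UZ by (rule eq_matI) simp_all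
      then have "eigen_hessian U B Z = - 2 \<cdot>\<^sub>m (Z * B)"
        by (simp add: eigen_hessian_def)
      also have "Z * B = (- (1/2)) \<cdot>\<^sub>m Y"
        by (simp add: Z_def smult_mult_dim mult_assoc_dim inverse(2))
      finally show ?thesis
        by (simp, intro eq_matI) simp_all
    qed
    ultimately show ?thesis by (metis imageI)
  qed
qed

lemma eigen_hessian_linear:
  assumes U: "U \<in> stiefel r n" and B: "B \<in> carrier_mat r r"
  shows "linear_map class_ring (real_mat_module n r (tangent_space r n U))
    (real_mat_module n r (tangent_space r n U)) (eigen_hessian U B)"
proof (rule linear_map_real_mat_moduleI[OF tangent_space_subspace[OF U]])
  note [simp] = stiefel_dims[OF U] carrier_matD[OF B]
  have c: "Z \<in> carrier_mat n r" if "Z \<in> tangent_space r n U" for Z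
    using that by (simp add: tangent_space_eq[OF U])
  show "eigen_hessian U B Z \<in> tangent_space r n U" if "Z \<in> tangent_space r n U" for Z
    by (rule tangent_if_adjoint_mult_0[OF U _ adjoint_mult_eigen_hessian[OF U B c[OF that]]])
      (rule carrier_matI, simp_all)
  show "eigen_hessian U B (Y + Z) = eigen_hessian U B Y + eigen_hessian U B Z"
    if "Y \<in> tangent_space r n U" "Z \<in> tangent_space r n U" for Y Z
  proof -
    note [simp] = carrier_matD[OF c[OF that(1)]] carrier_matD[OF c[OF that(2)]]
    show ?thesis
      unfolding eigen_hessian_def
      by (simp add: mat_ring_simps) (rule eq_matI, simp_all add: algebra_simps del: index_mult_mat(1))
  qed
  show "eigen_hessian U B (complex_of_real a \<cdot>\<^sub>m Z) = complex_of_real a \<cdot>\<^sub>m eigen_hessian U B Z"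
    if "Z \<in> tangent_space r n U" for a Z
  proof -
    note [simp] = carrier_matD[OF c[OF that]]
    show ?thesis
      unfolding eigen_hessian_def
      by (simp add: mat_ring_simps) (rule eq_matI, simp_all add: algebra_simps del: index_mult_mat(1))
  qed
qed

text \<open>
  At the critical point the derivative of the gradient field is already tangent, so that no
  projection has to be computed.
\<close>

lemma is_tangent_proj_self:
  assumes U: "U \<in> stiefel r n" and P: "P \<in> tangent_space r n U"
  shows "is_tangent_proj r n U P P"
  unfolding is_tangent_proj_def
proof (intro conjI P ballI)
  fix Y assume "Y \<in> tangent_space r n U"
  then have "Y \<in> carrier_mat n r" "P \<in> carrier_mat n r"
    using P by (simp_all add: tangent_space_eq[OF U])
  note [simp] = carrier_matD[OF this(1)] carrier_matD[OF this(2)]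
  show "re_inner (P - P) Y = 0"
    by (simp add: re_inner_minus_left)
qed

text \<open>
  The unitary \<open>F\<close> completes the columns of \<open>U\<close> to a basis; it enters only through the dimension of
  the horizontal space, the image of the Hessian.
\<close>

lemma eigen_quadratic_form_semi_nondegenerate:
  fixes F B S U :: "complex mat" and n r :: nat
  defines "U \<equiv> F * rect_id n r" and "S \<equiv> U * (B * mat_adjoint U)"
  assumes F: "F \<in> carrier_mat n n" "mat_adjoint F * F = 1\<^sub>m n" and rn: "r \<le> n"
    and B: "B \<in> carrier_mat r r" "mat_adjoint B = B"
    and nondeg: "n = r \<or> (\<exists>C\<in>carrier_mat r r. C * B = 1\<^sub>m r)"
    and h: "\<And>X. X \<in> stiefel r n \<Longrightarrow> h X = re_inner X (S * X)"
  shows "unitarily_semi_nondegenerate r n h U"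
proof -
  have U: "U \<in> stiefel r n"
    unfolding U_def by (rule unitary_leading_columns_stiefel[OF F rn])
  note [simp] = stiefel_dims[OF U] carrier_matD[OF F(1)] carrier_matD[OF B(1)]
  have S: "S \<in> carrier_mat n n" "mat_adjoint S = S"
    by (rule carrier_matI; simp add: S_def) (simp add: S_def adjoint_mult mult_assoc_dim B(2))
  note grad = quadratic_gradient_correct[OF S _ h]
  have "quadratic_gradient S U = 0\<^sub>m n r"
  proof -
    have "S * U = U * B"
      by (simp add: S_def mult_assoc_dim stiefelD(2)[OF U])
    moreover have "mat_adjoint U * (U * B) = B"
      by (simp add: mult_assoc_dim[symmetric] stiefelD(2)[OF U])
    ultimately show ?thesis
      unfolding quadratic_gradient_def by (intro eq_matI) (simp_all del: index_mult_mat(1))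
  qed
  with grad[OF U] have grad0: "has_riem_gradient r n h U (0\<^sub>m n r)"
    by simp
  have tangent: "eigen_hessian U B Z \<in> tangent_space r n U" if "stiefel_curve r n U \<gamma> Z" for \<gamma> Z
  proof -
    have "Z \<in> tangent_space r n U" using that unfolding tangent_space_def by blast
    then have "Z \<in> carrier_mat n r" by (simp add: tangent_space_eq[OF U])
    from adjoint_mult_eigen_hessian[OF U B(1) this] show ?thesis
      by (rule tangent_if_adjoint_mult_0[OF U, rotated]) (rule carrier_matI, simp_all)
  qed
  have hess: "has_riem_hessian r n h U (eigen_hessian U B)"
    unfolding has_riem_hessian_def
  proof (intro conjI eigen_hessian_linear[OF U B(1)] exI[of _ "quadratic_gradient S"] ballI allI impI)
    show "has_riem_gradient r n h X (quadratic_gradient S X)" if "X \<in> stiefel r n" for X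
      by (rule grad[OF that])
    fix \<gamma> Z assume \<gamma>: "stiefel_curve r n U \<gamma> Z"
    from quadratic_gradient_derivative_eigen[OF U B(1) this] is_tangent_proj_self[OF U tangent[OF \<gamma>]]
    show "\<exists>V. has_mat_derivative n r (\<lambda>t. quadratic_gradient S (\<gamma> t)) V 0
        \<and> is_tangent_proj r n U V (eigen_hessian U B Z)"
      unfolding S_def by blast
  qed
  let ?N = "{Y \<in> carrier_mat n r. mat_adjoint U * Y = 0\<^sub>m r r}"
  have N: "?N = {Y \<in> carrier_mat n r. \<forall>i<r. \<forall>j<r. (mat_adjoint F * Y) $$ (i, j) = 0}"
  proof (intro Collect_cong conj_cong refl)
    fix Y :: "complex mat" assume "Y \<in> carrier_mat n r"
    note [simp] = carrier_matD[OF this]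
    have "mat_adjoint U * Y = mat_adjoint (rect_id n r) * (mat_adjoint F * Y)"
      by (simp add: U_def adjoint_mult mult_assoc_dim)
    then have "(mat_adjoint U * Y) $$ (i, j) = (mat_adjoint F * Y) $$ (i, j)" if "i < r" "j < r" for i j
      using that rn by (simp add: index_adjoint_rect_id_mult del: index_mult_mat(1))
    then show "mat_adjoint U * Y = 0\<^sub>m r r \<longleftrightarrow> (\<forall>i<r. \<forall>j<r. (mat_adjoint F * Y) $$ (i, j) = 0)"
      by (simp add: mat_eq_iff del: index_mult_mat(1))
  qed
  have "real_rank_on_tangent r n U (eigen_hessian U B) = 2 * r * (n - r)"
    unfolding real_rank_on_tangent_def eigen_hessian_image[OF U B(1) nondeg]
    by (rule dim_lower_rows[OF F N adjoint_kernel_subspace[OF stiefelD(1)[OF U]] rn])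
  with U quadratic_form_unitarily_invariant[OF S(1) h] grad0 hess show ?thesis
    unfolding unitarily_semi_nondegenerate_def by blast
qed

section \<open>Multiple mode products\<close>

lemma sum_tensor_idx_Suc:
  "(\<Sum>k\<in>tensor_idx (Suc d) c. g k) = (\<Sum>x<c d. \<Sum>k\<in>tensor_idx d c. g (k(d := x)))"
proof -
  have "{..<Suc d} = insert d {..<d}" by auto
  then have "tensor_idx (Suc d) c = (\<lambda>(x, k). k(d := x)) ` ({..<c d} \<times> tensor_idx d c)"
    unfolding tensor_idx_def by (simp add: PiE_insert_eq)
  moreover have inj: "inj_on (\<lambda>(x, k). k(d := x)) ({..<c d} \<times> tensor_idx d c)"
    unfolding tensor_idx_def by (rule inj_combinator) simp
  ultimately show ?thesis
    using sum.reindex[OF inj, of g]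
    by (simp add: sum.cartesian_product o_def case_prod_beta)
qed

text \<open>
  For the induction on the number of modes \<open>p\<close> must be arbitrary: the partial products are evaluated
  at indices whose later entries still belong to the original tensor.
\<close>

lemma multi_mode_prod_eq_sum_gen:
  "multi_mode_prod d A X p = (\<Sum>k\<in>tensor_idx d (\<lambda>i. dim_col (X i)).
    A (\<lambda>i. if i < d then k i else p i) * (\<Prod>i<d. X i $$ (p i, k i)))"
proof (induction d arbitrary: p)
  case 0
  show ?case
    by (simp add: multi_mode_prod_def tensor_idx_def)
next
  case (Suc d)
  have 1: "(\<lambda>i. if i < Suc d then (k(d := x)) i else p i) = (\<lambda>i. if i < d then k i else (p(d := x)) i)" for k x
    by auto
  have 2: "(\<Prod>i<d. X i $$ ((p(d := x)) i, k i)) = (\<Prod>i<d. X i $$ (p i, k i))"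
      "(\<Prod>i<d. X i $$ (p i, (k(d := x)) i)) = (\<Prod>i<d. X i $$ (p i, k i))" for k x
    by (intro prod.cong; simp)+
  have "multi_mode_prod (Suc d) A X p = mode_prod (multi_mode_prod d A X) d (X d) p"
    by (simp add: multi_mode_prod_def)
  also have "\<dots> = (\<Sum>x<dim_col (X d). \<Sum>k\<in>tensor_idx d (\<lambda>i. dim_col (X i)).
      A (\<lambda>i. if i < d then k i else (p(d := x)) i) * ((\<Prod>i<d. X i $$ (p i, k i)) * X d $$ (p d, x)))"
    unfolding mode_prod_def Suc.IH 2 by (simp add: sum_distrib_right mult.assoc)
  also have "\<dots> = (\<Sum>k\<in>tensor_idx (Suc d) (\<lambda>i. dim_col (X i)).
      A (\<lambda>i. if i < Suc d then k i else p i) * (\<Prod>i<Suc d. X i $$ (p i, k i)))"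
    unfolding sum_tensor_idx_Suc 1 prod.lessThan_Suc 2 by simp
  finally show ?case .
qed

lemma multi_mode_prod_eq_sum:
  assumes p: "p \<in> tensor_idx d m"
  shows "multi_mode_prod d A X p =
    (\<Sum>k\<in>tensor_idx d (\<lambda>i. dim_col (X i)). A k * (\<Prod>i<d. X i $$ (p i, k i)))"
  unfolding multi_mode_prod_eq_sum_gen
proof (intro sum.cong refl arg_cong2[where f = "(*)"] arg_cong[where f = A] ext)
  fix k i assume "k \<in> tensor_idx d (\<lambda>i. dim_col (X i))"
  with p show "(if i < d then k i else p i) = k i"
    unfolding tensor_idx_def by (auto simp: PiE_def extensional_def)
qed

lemma multi_mode_prod_comp:
  assumes p: "p \<in> tensor_idx d m" and m: "\<And>i. i < d \<Longrightarrow> m i \<le> dim_row (Y i)"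
    and dims: "\<And>i. i < d \<Longrightarrow> dim_col (Y i) = dim_row (X i)"
  shows "multi_mode_prod d (multi_mode_prod d A X) Y p =
    multi_mode_prod d A (\<lambda>i. Y i * X i) p"
proof -
  let ?K = "tensor_idx d (\<lambda>i. dim_col (Y i))" and ?L = "tensor_idx d (\<lambda>i. dim_col (X i))"
  have "multi_mode_prod d (multi_mode_prod d A X) Y p
      = (\<Sum>k\<in>?K. \<Sum>l\<in>?L. A l * ((\<Prod>i<d. Y i $$ (p i, k i)) * (\<Prod>i<d. X i $$ (k i, l i))))"
    unfolding multi_mode_prod_eq_sum[OF p]
    by (intro sum.cong refl) (simp add: multi_mode_prod_eq_sum sum_distrib_left sum_distrib_right mult_ac)
  also have "\<dots> = (\<Sum>l\<in>?L. A l * (\<Sum>k\<in>?K. \<Prod>i<d. Y i $$ (p i, k i) * X i $$ (k i, l i)))"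
    by (subst sum.swap) (simp add: sum_distrib_left prod.distrib)
  also have "\<dots> = (\<Sum>l\<in>?L. A l * (\<Prod>i<d. \<Sum>k<dim_col (Y i). Y i $$ (p i, k) * X i $$ (k, l i)))"
    unfolding tensor_idx_def by (subst prod_sum_PiE) simp_all
  also have "\<dots> = (\<Sum>l\<in>?L. A l * (\<Prod>i<d. (Y i * X i) $$ (p i, l i)))"
  proof (intro sum.cong refl arg_cong2[where f = "(*)"] prod.cong)
    fix l i assume "l \<in> ?L" "i \<in> {..<d}"
    then have "i < d" "l i < dim_col (X i)" unfolding tensor_idx_def by auto
    moreover have "p i < m i"
      using p \<open>i < d\<close> unfolding tensor_idx_def by auto
    with m[OF \<open>i < d\<close>] have "p i < dim_row (Y i)"
      by (rule less_le_trans[rotated])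
    ultimately show "(\<Sum>k<dim_col (Y i). Y i $$ (p i, k) * X i $$ (k, l i)) = (Y i * X i) $$ (p i, l i)"
      by (simp add: index_mult_sum dims del: index_mult_mat(1))
  qed
  finally show ?thesis
    by (simp add: multi_mode_prod_eq_sum[OF p])
qed

section \<open>Diagonal tensors with all but one mode fixed\<close>

lemma diag_idx_in_tensor_idx: "(\<And>i. i < d \<Longrightarrow> k < n i) \<Longrightarrow> diag_idx d k \<in> tensor_idx d n"
  unfolding diag_idx_def tensor_idx_def by auto

lemma diag_idx_apply [simp]: "i < d \<Longrightarrow> diag_idx d k i = k"
  unfolding diag_idx_def by simp

text \<open>
  The product runs over identity-like matrices except in mode \<open>i\<close>.  In the sum over the diagonal
  indices \<open>(k, \<dots>, k)\<close> each mode \<open>j \<noteq> i\<close> forces \<open>k = p j\<close>; there is at least one such mode \<open>j0\<close>,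
  and hence at most one summand survives.
\<close>

lemma diagonal_multi_mode_prod:
  assumes D: "diagonal_tensor d n D" and p: "p \<in> tensor_idx d (\<lambda>_. r)" and r: "\<And>j. j < d \<Longrightarrow> r \<le> n j"
    and i: "i < d" and j0: "j0 < d" "j0 \<noteq> i"
    and cols: "\<And>j. j < d \<Longrightarrow> dim_col (P j) = n j"
    and P: "\<And>j a b. j < d \<Longrightarrow> j \<noteq> i \<Longrightarrow> a < r \<Longrightarrow> b < n j \<Longrightarrow> P j $$ (a, b) = (if a = b then 1 else 0)"
  shows "multi_mode_prod d D P p =
    (if \<forall>j<d. j \<noteq> i \<longrightarrow> p j = p j0 then D (diag_idx d (p j0)) * P i $$ (p i, p j0) else 0)"
proof -
  have pr: "p j < r" if "j < d" for j
    using p that unfolding tensor_idx_def by auto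
  let ?q0 = "diag_idx d (p j0)"
  let ?good = "\<forall>j<d. j \<noteq> i \<longrightarrow> p j = p j0"
  have idx: "tensor_idx d (\<lambda>j. dim_col (P j)) = tensor_idx d n"
    unfolding tensor_idx_def by (intro PiE_cong) (simp add: cols)
  have fin: "finite (tensor_idx d n)"
    unfolding tensor_idx_def by (intro finite_PiE) auto
  have q0: "?q0 \<in> tensor_idx d n"
    using pr[OF j0(1)] r by (intro diag_idx_in_tensor_idx) (meson less_le_trans)
  have zero: "D q * (\<Prod>j<d. P j $$ (p j, q j)) = 0"
    if q: "q \<in> tensor_idx d n" and "\<not> (?good \<and> q = ?q0)" for q
  proof (cases "D q = 0")
    case False
    with D q obtain k where k: "q = diag_idx d k" unfolding diagonal_tensor_def by blast
    have "\<exists>j<d. j \<noteq> i \<and> p j \<noteq> k"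
      using that(2) j0 unfolding k by metis
    then obtain j where j: "j < d" "j \<noteq> i" "p j \<noteq> k" by blast
    moreover have "k < n j"
      using q j(1) unfolding k tensor_idx_def by (auto simp: PiE_iff)
    ultimately have "P j $$ (p j, q j) = 0"
      unfolding k by (simp add: P pr)
    then show ?thesis using j(1) by (auto intro!: prod_zero)
  qed simp
  have "multi_mode_prod d D P p = (\<Sum>q\<in>tensor_idx d n. D q * (\<Prod>j<d. P j $$ (p j, q j)))"
    by (simp add: multi_mode_prod_eq_sum[OF p] idx)
  also have "\<dots> = (if ?good then D ?q0 * (\<Prod>j<d. P j $$ (p j, ?q0 j)) else 0)"
  proof (cases ?good)
    case True
    have "(\<Sum>q\<in>tensor_idx d n. D q * (\<Prod>j<d. P j $$ (p j, q j)))
        = (\<Sum>q\<in>{?q0}. D q * (\<Prod>j<d. P j $$ (p j, q j)))"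
      using fin q0 zero by (intro sum.mono_neutral_right) auto
    with True show ?thesis by simp
  next
    case False
    then have "(\<Sum>q\<in>tensor_idx d n. D q * (\<Prod>j<d. P j $$ (p j, q j))) = 0"
      by (intro sum.neutral ballI zero) blast+
    with False show ?thesis by (simp only: if_False)
  qed
  also have "\<dots> = (if ?good then D ?q0 * P i $$ (p i, p j0) else 0)"
  proof (cases ?good)
    case True
    have "(\<Prod>j<d. P j $$ (p j, ?q0 j)) = P i $$ (p i, ?q0 i) * (\<Prod>j\<in>{..<d} - {i}. P j $$ (p j, ?q0 j))"
      using i by (intro prod.remove) auto
    also have "(\<Prod>j\<in>{..<d} - {i}. P j $$ (p j, ?q0 j)) = 1"
    proof (intro prod.neutral ballI)
      fix j assume "j \<in> {..<d} - {i}"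
      then have j: "j < d" "j \<noteq> i" by auto
      moreover have "p j0 < n j" using pr[OF j0(1)] r[OF j(1)] by simp
      ultimately show "P j $$ (p j, ?q0 j) = 1"
        using True pr[OF j0(1)] by (simp add: P)
    qed
    finally show ?thesis unfolding if_P[OF True] using i by simp
  next
    case False
    then show ?thesis by (simp only: if_False)
  qed
  finally show ?thesis .
qed

text \<open>
  The entries that can be nonzero have the indices \<open>(k, \<dots>, k, m, k, \<dots>, k)\<close> with \<open>m\<close> in position \<open>i\<close>.
  The parametrisation \<open>e\<close> of these by \<open>(k, m)\<close> is injective since there is a second mode.
\<close>

lemma frobenius_norm_diagonal_multi_mode_prod:
  assumes d: "1 < d"
    and D: "diagonal_tensor d n D" and r: "\<And>j. j < d \<Longrightarrow> r \<le> n j"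
    and i: "i < d" and cols: "\<And>j. j < d \<Longrightarrow> dim_col (P j) = n j"
    and P: "\<And>j a b. j < d \<Longrightarrow> j \<noteq> i \<Longrightarrow> a < r \<Longrightarrow> b < n j \<Longrightarrow> P j $$ (a, b) = (if a = b then 1 else 0)"
    and W: "\<And>p. p \<in> tensor_idx d (\<lambda>_. r) \<Longrightarrow> W p = multi_mode_prod d D P p"
  shows "(frobenius_norm d (\<lambda>_. r) W)\<^sup>2 =
    (\<Sum>k<r. (cmod (D (diag_idx d k)))\<^sup>2 * (\<Sum>m<r. (cmod (P i $$ (m, k)))\<^sup>2))"
proof -
  let ?I = "tensor_idx d (\<lambda>_. r)"
  define j0 where "j0 = (if i = 0 then 1 else 0 :: nat)"
  have j0: "j0 < d" "j0 \<noteq> i" using d by (auto simp: j0_def)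
  define e where "e = (\<lambda>(k, m). (diag_idx d k)(i := m))"
  have W': "W p = (if \<forall>j<d. j \<noteq> i \<longrightarrow> p j = p j0 then D (diag_idx d (p j0)) * P i $$ (p i, p j0) else 0)"
    if "p \<in> ?I" for p
    using W[OF that] diagonal_multi_mode_prod[OF D that r i j0 cols P] by simp
  have fin: "finite ?I"
    unfolding tensor_idx_def by (intro finite_PiE) auto
  have e_in: "e (k, m) \<in> ?I" if "k < r" "m < r" for k m
    using that i unfolding e_def tensor_idx_def diag_idx_def by (auto simp: PiE_iff extensional_def)
  have inj: "inj_on e ({..<r} \<times> {..<r})"
  proof (rule inj_onI, clarify)
    fix k m k' m' assume "e (k, m) = e (k', m')"
    then have "e (k, m) j0 = e (k', m') j0" "e (k, m) i = e (k', m') i" by simp_all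
    then show "k = k' \<and> m = m'" using j0 by (simp add: e_def)
  qed
  have outside: "W p = 0" if p: "p \<in> ?I - e ` ({..<r} \<times> {..<r})" for p
  proof (rule ccontr)
    assume "W p \<noteq> 0"
    then have good: "\<forall>j<d. j \<noteq> i \<longrightarrow> p j = p j0"
      using W'[of p] p by (auto split: if_splits)
    have "p = e (p j0, p i)"
    proof
      fix j show "p j = e (p j0, p i) j"
        using p good i by (cases "j < d")
          (auto simp: e_def diag_idx_def tensor_idx_def PiE_iff extensional_def)
    qed
    moreover have "p j0 < r" "p i < r"
      using p i j0 unfolding tensor_idx_def by auto
    ultimately show False using p by blast
  qed
  have We: "W (e (k, m)) = D (diag_idx d k) * P i $$ (m, k)" if "k < r" "m < r" for k m
  proof -
    have "e (k, m) j = k" if "j < d" "j \<noteq> i" for j using that by (simp add: e_def)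
    moreover have "e (k, m) i = m" by (simp add: e_def)
    ultimately show ?thesis
      using W'[OF e_in[OF that]] j0 by simp
  qed
  have "(frobenius_norm d (\<lambda>_. r) W)\<^sup>2 = (\<Sum>p\<in>?I. (cmod (W p))\<^sup>2)"
    unfolding frobenius_norm_def by (simp add: sum_nonneg)
  also have "\<dots> = (\<Sum>p\<in>e ` ({..<r} \<times> {..<r}). (cmod (W p))\<^sup>2)"
    using fin e_in outside by (intro sum.mono_neutral_right) auto
  also have "\<dots> = (\<Sum>(k, m)\<in>{..<r} \<times> {..<r}. (cmod (D (diag_idx d k)))\<^sup>2 * (cmod (P i $$ (m, k)))\<^sup>2)"
    unfolding sum.reindex[OF inj]
    by (intro sum.cong) (auto simp: We norm_mult power_mult_distrib)
  also have "\<dots> = (\<Sum>k<r. (cmod (D (diag_idx d k)))\<^sup>2 * (\<Sum>m<r. (cmod (P i $$ (m, k)))\<^sup>2))"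
    by (simp add: sum.cartesian_product[symmetric] sum_distrib_left)
  finally show ?thesis .
qed

section \<open>The objective function with all but one factor fixed\<close>

lemma mat_adjoint_of_real:
  "mat_adjoint (map_mat complex_of_real R) = transpose_mat (map_mat complex_of_real R)"
  by (rule eq_matI) simp_all

lemma dag_of_real:
  assumes "dag = mat_adjoint \<or> dag = transpose_mat"
  shows "dag (map_mat complex_of_real R) = mat_adjoint (map_mat complex_of_real R)"
  using assms by (auto simp: mat_adjoint_of_real)

lemma of_real_orthogonal_unitary:
  assumes "R \<in> carrier_mat n n" "transpose_mat R * R = 1\<^sub>m n"
  shows "mat_adjoint (map_mat complex_of_real R) * map_mat complex_of_real R = 1\<^sub>m n"
proof -
  have "map_mat complex_of_real (transpose_mat R * R) = map_mat complex_of_real (1\<^sub>m n)"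
    by (simp add: assms(2))
  moreover have "map_mat complex_of_real (transpose_mat R * R)
      = map_mat complex_of_real (transpose_mat R) * map_mat complex_of_real R"
    using assms(1) by (intro of_real_hom.mat_hom_mult[of _ n n _ n]) simp_all
  moreover have "map_mat complex_of_real (transpose_mat R) = mat_adjoint (map_mat complex_of_real R)"
    by (rule eq_matI) simp_all
  moreover have "map_mat complex_of_real (1\<^sub>m n) = (1\<^sub>m n :: complex mat)"
    by (rule eq_matI) simp_all
  ultimately show ?thesis by metis
qed

lemma cmod_dag_mult_of_real:
  assumes dag: "dag = mat_adjoint \<or> dag = transpose_mat"
    and R: "R \<in> carrier_mat n n" and U: "U \<in> carrier_mat n r" and "m < r" "k < n"
  shows "cmod ((dag U * map_mat complex_of_real R) $$ (m, k))
    = cmod ((mat_adjoint (map_mat complex_of_real R) * U) $$ (k, m))"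
proof -
  note [simp] = carrier_matD[OF R] carrier_matD[OF U]
  let ?x = "(mat_adjoint (map_mat complex_of_real R) * U) $$ (k, m)"
  have "(dag U * map_mat complex_of_real R) $$ (m, k) = (if dag = transpose_mat then ?x else cnj ?x)"
    using assms(1,4,5) by (auto simp: index_mult_sum mult.commute simp del: index_mult_mat(1))
  then show ?thesis by simp
qed

text \<open>The matrix of \<open>\<Sum>\<^sub>k \<beta>\<^sub>k |(F\<^sup>H X)\<^sub>k\<^sub>m|\<^sup>2\<close> as a quadratic form in \<open>X\<close>.\<close>

lemma re_inner_leading_columns:
  fixes F X :: "complex mat" and \<beta> :: "nat \<Rightarrow> real" and n r :: nat
  defines "U \<equiv> F * rect_id n r" and "B \<equiv> mat_diag r (\<lambda>k. complex_of_real (\<beta> k))"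
  assumes F: "F \<in> carrier_mat n n" and X: "X \<in> carrier_mat n r" and rn: "r \<le> n"
  shows "re_inner X (U * (B * mat_adjoint U) * X) =
    (\<Sum>k<r. \<beta> k * (\<Sum>m<r. (cmod ((mat_adjoint F * X) $$ (k, m)))\<^sup>2))"
proof -
  note [simp] = carrier_matD[OF F] carrier_matD[OF X]
  have [simp]: "dim_row U = n" "dim_col U = r" "dim_row B = r" "dim_col B = r"
    by (simp_all add: U_def B_def mat_diag_def)
  define Y where "Y = mat_adjoint U * X"
  have [simp]: "dim_row Y = r" "dim_col Y = r" by (simp_all add: Y_def)
  have "Y = mat_adjoint (rect_id n r) * (mat_adjoint F * X)"
    by (simp add: Y_def U_def adjoint_mult mult_assoc_dim)
  then have Y: "Y $$ (k, m) = (mat_adjoint F * X) $$ (k, m)" if "k < r" "m < r" for k m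
    using that rn by (simp add: index_adjoint_rect_id_mult del: index_mult_mat(1))
  have BY: "B * Y = mat r r (\<lambda>(k, m). complex_of_real (\<beta> k) * Y $$ (k, m))"
    unfolding B_def by (rule mat_diag_mult_left) (rule carrier_matI, simp_all)
  have "re_inner X (U * (B * mat_adjoint U) * X) = re_inner (U * (B * Y)) X"
    by (simp add: mult_assoc_dim re_inner_commute Y_def)
  also have "\<dots> = re_inner Y (B * Y)"
    by (simp add: re_inner_mult_left re_inner_commute Y_def)
  also have "\<dots> = (\<Sum>m<r. \<Sum>k<r. Re (cnj (Y $$ (k, m)) * (B * Y) $$ (k, m)))"
    by (simp add: re_inner_sum del: index_mult_mat(1))
  also have "\<dots> = (\<Sum>m<r. \<Sum>k<r. \<beta> k * (cmod (Y $$ (k, m)))\<^sup>2)"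
    unfolding cmod_power2 BY
    by (intro sum.cong refl) (simp add: power2_eq_square algebra_simps)
  also have "\<dots> = (\<Sum>k<r. \<beta> k * (\<Sum>m<r. (cmod (Y $$ (k, m)))\<^sup>2))"
    by (subst sum.swap) (simp add: sum_distrib_left)
  finally show ?thesis by (simp add: Y)
qed

text \<open>
  Composing the mode products replaces the factor in mode \<open>j\<close> by \<open>U\<^sub>j\<^sup>\<dagger> Q\<^sub>j\<close>.  For the fixed factors
  \<open>U\<^sub>j = Q\<^sub>j I\<close> this is the rectangular identity, so only the variable factor \<open>U\<^sup>\<dagger> Q\<^sub>i\<close> contributes.
\<close>

lemma objective_restricted:
  fixes Q :: "nat \<Rightarrow> real mat"
  assumes d: "1 < d"
    and dag: "dag = mat_adjoint \<or> dag = transpose_mat"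
    and D: "\<And>l. l < L \<Longrightarrow> diagonal_tensor d n (D l)"
    and Q: "\<And>i. i < d \<Longrightarrow> Q i \<in> carrier_mat (n i) (n i)"
      "\<And>i. i < d \<Longrightarrow> transpose_mat (Q i) * Q i = 1\<^sub>m (n i)"
    and A: "\<And>l. l < L \<Longrightarrow> A l = multi_mode_prod d (D l)
      (\<lambda>i. dag (mat_adjoint (map_mat complex_of_real (Q i))))"
    and r: "\<And>i. i < d \<Longrightarrow> r \<le> n i"
    and i: "i < d" and U: "U \<in> carrier_mat (n i) r"
  shows "objective d r L dag \<alpha> A
      ((\<lambda>j. map_mat complex_of_real (Q j) * rect_id (n j) r)(i := U))
    = (\<Sum>k<r. (\<Sum>l<L. \<alpha> l * (cmod (D l (diag_idx d k)))\<^sup>2)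
        * (\<Sum>m<r. (cmod ((mat_adjoint (map_mat complex_of_real (Q i)) * U) $$ (k, m)))\<^sup>2))"
proof -
  define F where "F j = map_mat complex_of_real (Q j)" for j
  define \<omega> where "\<omega> = (\<lambda>j. F j * rect_id (n j) r)(i := U)"
  define P where "P j = dag (\<omega> j) * F j" for j
  have [simp]: "dim_row (F j) = n j" "dim_col (F j) = n j" if "j < d" for j
    using carrier_matD[OF Q(1)[OF that]] by (simp_all add: F_def)
  have F: "mat_adjoint (F j) * F j = 1\<^sub>m (n j)" if "j < d" for j
    unfolding F_def using Q[OF that] by (rule of_real_orthogonal_unitary)
  have dag_F: "dag (mat_adjoint (F j)) = F j" for j
    using dag by (auto simp: F_def mat_adjoint_of_real)
  have dims_dag: "dim_row (dag X) = dim_col X" "dim_col (dag X) = dim_row X" for X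
    using dag by auto
  have dims: "dim_row (\<omega> j) = n j" "dim_col (\<omega> j) = r" if "j < d" for j
    using that carrier_matD[OF U] by (simp_all add: \<omega>_def)
  have P: "P j $$ (a, b) = (if a = b then 1 else 0)" if "j < d" "j \<noteq> i" "a < r" "b < n j" for j a b
  proof -
    \<comment> \<open>The entries of this factor are real, so both choices of \<open>dag\<close> give its adjoint.\<close>
    have "F j * rect_id (n j) r = map_mat complex_of_real (Q j * mat (n j) r (\<lambda>(i, j). if i = j then 1 else 0))"
    proof -
      have "rect_id (n j) r = map_mat complex_of_real (mat (n j) r (\<lambda>(i, j). if i = j then 1 else 0))"
        unfolding rect_id_def by (rule eq_matI) simp_all
      then show ?thesis
        using of_real_hom.mat_hom_mult[OF Q(1)[OF that(1)], of "mat (n j) r (\<lambda>(i, j). if i = j then 1 else 0)" r,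
            where ?'a = complex]
        by (simp add: F_def)
    qed
    then have "dag (\<omega> j) = mat_adjoint (F j * rect_id (n j) r)"
      using that(2) by (simp add: \<omega>_def dag_of_real[OF dag])
    then have "P j = mat_adjoint (rect_id (n j) r) * (mat_adjoint (F j) * F j)"
      using that(1) by (simp add: P_def adjoint_mult mult_assoc_dim)
    then show ?thesis
      using that r[OF that(1)] by (simp add: F index_adjoint_rect_id_mult del: index_mult_mat(1) right_mult_one_mat')
  qed
  have W: "multi_mode_prod d (A l) (\<lambda>j. dag (\<omega> j)) p = multi_mode_prod d (D l) P p"
    if "l < L" "p \<in> tensor_idx d (\<lambda>_. r)" for l p
    unfolding A[OF that(1)] P_def F_def[symmetric] dag_F
    by (rule multi_mode_prod_comp[OF that(2)]) (simp_all add: dims_dag dims)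
  have cols: "dim_col (P j) = n j" if "j < d" for j
    using that by (simp add: P_def)
  define S where "S k = (\<Sum>m<r. (cmod (P i $$ (m, k)))\<^sup>2)" for k
  have "objective d r L dag \<alpha> A \<omega> = (\<Sum>l<L. \<alpha> l * (\<Sum>k<r. (cmod (D l (diag_idx d k)))\<^sup>2 * S k))"
    unfolding objective_def S_def
    by (intro sum.cong refl arg_cong2[where f = "(*)"]
        frobenius_norm_diagonal_multi_mode_prod[OF d D r i cols P W]) simp_all
  also have "\<dots> = (\<Sum>k<r. (\<Sum>l<L. \<alpha> l * (cmod (D l (diag_idx d k)))\<^sup>2) * S k)"
    unfolding sum_distrib_left sum_distrib_right mult.assoc by (rule sum.swap)
  also have "\<dots> = (\<Sum>k<r. (\<Sum>l<L. \<alpha> l * (cmod (D l (diag_idx d k)))\<^sup>2)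
        * (\<Sum>m<r. (cmod ((mat_adjoint (F i) * U) $$ (k, m)))\<^sup>2))"
    unfolding S_def
  proof (intro sum.cong refl arg_cong2[where f = "(*)"] arg_cong[where f = "\<lambda>x. x\<^sup>2"])
    fix k m assume "k \<in> {..<r}" "m \<in> {..<r}"
    with r[OF i] have "m < r" "k < n i" by auto
    from cmod_dag_mult_of_real[OF dag Q(1)[OF i] U this]
    show "cmod (P i $$ (m, k)) = cmod ((mat_adjoint (F i) * U) $$ (k, m))"
      by (simp add: P_def \<omega>_def F_def)
  qed
  finally show ?thesis
    unfolding \<omega>_def F_def .
qed

theorem proposition7p12:
  fixes d r L :: nat
    and n rs :: "nat \<Rightarrow> nat"
    and dag :: "complex mat \<Rightarrow> complex mat"
    and D A :: "nat \<Rightarrow> ctensor"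
    and \<alpha> :: "nat \<Rightarrow> real"
    and Q :: "nat \<Rightarrow> real mat"
  assumes d: "1 < d"
    and dag: "dag = mat_adjoint \<or> dag = transpose_mat"
    and D: "\<forall>l<L. diagonal_tensor d n (D l)"
    and \<alpha>: "\<forall>l<L. 0 \<le> \<alpha> l"
    and Q_carrier: "\<forall>i<d. Q i \<in> carrier_mat (n i) (n i)"
    and Q_orthogonal: "\<forall>i<d. transpose_mat (Q i) * Q i = 1\<^sub>m (n i)"
    and A: "\<forall>l<L. A l = multi_mode_prod d (D l)
                  (\<lambda>i. dag (mat_adjoint (map_mat complex_of_real (Q i))))"
    and rs: "\<forall>i<d. rs i = r"
    and r: "1 \<le> r" "\<forall>i<d. r \<le> n i"
    and cond_a: "\<forall>s<r - rs 0. \<forall>t<rs 0.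
      (\<Sum>l<L. \<alpha> l * ((cmod (D l (diag_idx d (rs 0 + s))))\<^sup>2 - (cmod (D l (diag_idx d t)))\<^sup>2)) \<noteq> 0"
    and cond_b: "(\<exists>i<d. r < n i) \<longrightarrow>
      (\<forall>p<rs 0. (\<Sum>l<L. \<alpha> l * (cmod (D l (diag_idx d p)))\<^sup>2) \<noteq> 0)"
  shows "unitarily_semi_nondegenerate_prod d r n (objective d r L dag \<alpha> A)
    (\<lambda>i. map_mat complex_of_real (Q i) * rect_id (n i) r)"
  unfolding unitarily_semi_nondegenerate_prod_def
proof (intro allI impI)
  fix i assume i: "i < d"
  define F where "F = map_mat complex_of_real (Q i)"
  define \<beta> where "\<beta> k = (\<Sum>l<L. \<alpha> l * (cmod (D l (diag_idx d k)))\<^sup>2)" for k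
  define B where "B = mat_diag r (\<lambda>k. complex_of_real (\<beta> k))"
  define U where "U = F * rect_id (n i) r"
  have F: "F \<in> carrier_mat (n i) (n i)" "mat_adjoint F * F = 1\<^sub>m (n i)"
    using Q_carrier Q_orthogonal i unfolding F_def by (simp, simp add: of_real_orthogonal_unitary)
  have rn: "r \<le> n i" using r(2) i by blast
  have B: "B \<in> carrier_mat r r" "mat_adjoint B = B"
    unfolding B_def by (simp, rule eq_matI) (simp_all add: mat_diag_def)
  have nondeg: "n i = r \<or> (\<exists>C\<in>carrier_mat r r. C * B = 1\<^sub>m r)"
  proof (cases "n i = r")
    case False
    with rn i have "\<exists>i<d. r < n i" by (intro exI[of _ i]) simp
    moreover have "rs 0 = r" using rs d by simp
    ultimately have "\<forall>k<r. \<beta> k \<noteq> 0"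
      using cond_b unfolding \<beta>_def by simp
    then have "mat_diag r (\<lambda>k. 1 / complex_of_real (\<beta> k)) * B = 1\<^sub>m r"
      unfolding B_def mat_diag_diag by (intro eq_matI) (auto simp: mat_diag_def)
    then show ?thesis by (meson mat_diag_dim)
  qed simp
  have objective: "objective d r L dag \<alpha> A ((\<lambda>j. map_mat complex_of_real (Q j) * rect_id (n j) r)(i := X))
      = re_inner X (U * (B * mat_adjoint U) * X)" if "X \<in> stiefel r (n i)" for X
    unfolding U_def B_def re_inner_leading_columns[OF F(1) stiefelD(1)[OF that] rn]
    unfolding \<beta>_def F_def
    by (rule objective_restricted) (use assms i stiefelD(1)[OF that] in simp_all)
  have "unitarily_semi_nondegenerate r (n i) (\<lambda>X. objective d r L dag \<alpha> A
      ((\<lambda>j. map_mat complex_of_real (Q j) * rect_id (n j) r)(i := X))) U"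
    unfolding U_def
    by (rule eigen_quadratic_form_semi_nondegenerate[OF F rn B nondeg objective[unfolded U_def]])
  then show "unitarily_semi_nondegenerate r (n i) (\<lambda>X. objective d r L dag \<alpha> A
      ((\<lambda>j. map_mat complex_of_real (Q j) * rect_id (n j) r)(i := X)))
      (map_mat complex_of_real (Q i) * rect_id (n i) r)"
    unfolding U_def F_def .
qed

end
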